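(* Let $Y$ be a connected real analytic submanifold of $\mathbb R^n$ of dimension $d\ge 2$ that is not contained in any rational affine hyperplane of $\mathbb R^n$, let $f:\mathbb R_{>0}\to\mathbb R_{>0}$ be positive and non-increasing, and let $1\le g\le d-1$. Then $Y\cap\operatorname{UA}^*_{1,n}(f;g)$ is dense in $Y$ and uncountable.
   Context: For $f:\mathbb R_{>0}\to\mathbb R_{>0}$ and $1\le g\le n$, a vector $\mathbf{x}\in\mathbb R^n$ is $f$-uniform of order $g$ (written $\mathbf{x}\in\operatorname{UA}_{1,n}(f;g)$) if for every sufficiently large $t>0$ there exist linearly independent $\mathbf{q}_1,\dots,\mathbf{q}_g\in\mathbb Z^n$ and $p_1,\dots,p_g\in\mathbb Z$ such that $\|\mathbf{q}_i\|\le t$ and $|\mathbf{q}_i\cdot\mathbf{x}-p_i|\le f(t)$ for all $i=1,\dots,g$ (here $\|\cdot\|$ is the sup norm). $\operatorname{UA}^*_{1,n}(f;g)$ is the set of $\mathbf{x}\in\operatorname{UA}_{1,n}(f;g)$ that are totally irrational, i.e. not contained in any proper rational affine subspace of $\mathbb R^n$. *)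

theory Defs
  imports "HOL-Analysis.Analysis"
begin

text \<open>Real analytic maps between Euclidean spaces, on an open set \<open>S\<close>: around every point of
  \<open>S\<close> the map is the sum of a multivariate power series.  Multi-indices are functions
  \<open>'m \<Rightarrow> nat\<close>, and \<open>has_sum\<close> is unconditional (equivalently, absolute) convergence.\<close>

definition real_analytic_on :: "(real ^ 'm) set \<Rightarrow> (real ^ 'm \<Rightarrow> real ^ 'k) \<Rightarrow> bool" where
  "real_analytic_on S F \<longleftrightarrow> open S \<and>
     (\<forall>x\<in>S. \<exists>r>0. \<exists>c :: ('m \<Rightarrow> nat) \<Rightarrow> real ^ 'k. \<forall>h. (\<forall>i. \<bar>h $ i\<bar> < r) \<longrightarrow>
        ((\<lambda>\<alpha>. (\<Prod>i\<in>UNIV. (h $ i) ^ \<alpha> i) *\<^sub>R c \<alpha>) has_sum F (x + h)) UNIV)"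

text \<open>Embedded real analytic submanifolds of dimension \<open>d\<close>, not necessarily closed, via slice
  charts: an ambient real analytic diffeomorphism \<open>\<phi>\<close> with inverse \<open>\<psi>\<close> flattens \<open>Y\<close> locally onto
  an open piece of a \<open>d\<close>-dimensional linear subspace.\<close>

definition analytic_submanifold :: "nat \<Rightarrow> (real ^ 'n) set \<Rightarrow> bool" where
  "analytic_submanifold d Y \<longleftrightarrow>
     (\<forall>y\<in>Y. \<exists>U V (\<phi> :: real ^ 'n \<Rightarrow> real ^ 'n) \<psi> L. open U \<and> y \<in> U \<and> open V \<and> homeomorphism U V \<phi> \<psi> \<and>
        real_analytic_on U \<phi> \<and> real_analytic_on V \<psi> \<and>
        subspace L \<and> dim L = d \<and> \<phi> ` (Y \<inter> U) = V \<inter> L)"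

definition rational_vec :: "real ^ 'n \<Rightarrow> bool" where
  "rational_vec a \<longleftrightarrow> (\<forall>i. a $ i \<in> \<rat>)"

definition integer_vec :: "real ^ 'n \<Rightarrow> bool" where
  "integer_vec a \<longleftrightarrow> (\<forall>i. a $ i \<in> \<int>)"

definition rational_affine_hyperplane :: "(real ^ 'n) set \<Rightarrow> bool" where
  "rational_affine_hyperplane H \<longleftrightarrow>
     (\<exists>a b. rational_vec a \<and> a \<noteq> 0 \<and> b \<in> \<rat> \<and> H = {x. a \<bullet> x = b})"

text \<open>Affine subspaces defined over the rationals, i.e. solution sets of systems \<open>E\<close> of linear
  equations with rational coefficients.  The empty set is included, which is harmless below.\<close>

definition rational_affine_subspace :: "(real ^ 'n) set \<Rightarrow> bool" where
  "rational_affine_subspace A \<longleftrightarrow>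
     (\<exists>E. (\<forall>(a, b)\<in>E. rational_vec a \<and> b \<in> \<rat>) \<and> A = {x. \<forall>(a, b)\<in>E. a \<bullet> x = b})"

definition totally_irrational :: "real ^ 'n \<Rightarrow> bool" where
  "totally_irrational x \<longleftrightarrow> (\<forall>A. rational_affine_subspace A \<and> A \<noteq> UNIV \<longrightarrow> x \<notin> A)"

text \<open>\<open>infnorm\<close> is the sup norm.  Injectivity of \<open>q\<close> makes the vectors independent as a family and
  not merely as a set.  Only the values of \<open>f\<close> at positive arguments matter.\<close>

definition UA :: "(real \<Rightarrow> real) \<Rightarrow> nat \<Rightarrow> (real ^ 'n) set" where
  "UA f g = {x. \<forall>\<^sub>F t in at_top. \<exists>(q :: nat \<Rightarrow> real ^ 'n) (p :: nat \<Rightarrow> int).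
     inj_on q {1..g} \<and> independent (q ` {1..g}) \<and>
     (\<forall>i\<in>{1..g}. integer_vec (q i) \<and> infnorm (q i) \<le> t \<and> \<bar>q i \<bullet> x - of_int (p i)\<bar> \<le> f t)}"

definition UA_star :: "(real \<Rightarrow> real) \<Rightarrow> nat \<Rightarrow> (real ^ 'n) set" where
  "UA_star f g = {x \<in> UA f g. totally_irrational x}"

end

theory Submission
  imports Defs "HOL-Complex_Analysis.Conformal_Mappings"
begin

text \<open>
  Since \<open>Y\<close> has full rank over \<open>d\<close> suitable coordinates \<open>J\<close>, it is locally a graph \<open>x \<mapsto> G x\<close> over an open
  subset of \<open>\<real>\<^sup>J\<close>, and for integer vectors \<open>q\<close> supported in \<open>J\<close> one has \<open>q \<bullet> G x = q \<bullet> x\<close>.  A rational line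
  in \<open>\<real>\<^sup>J\<close> is cut out by \<open>d - 1 \<ge> g\<close> independent integer equations, so, in the manner of Khintchine, one
  constructs rational points \<open>x\<^sub>k\<close> on rational lines \<open>\<ell>\<^sub>k\<close>: the next line passes through \<open>x\<^sub>k\<close>, and \<open>x\<^sub>k\<^sub>+\<^sub>1\<close> is taken
  on it so close to \<open>x\<^sub>k\<close> that the equations of \<open>\<ell>\<^sub>k\<close> stay valid up to \<open>f(T)\<close>, \<open>T\<close> being the size of the
  equations of \<open>\<ell>\<^sub>k\<^sub>+\<^sub>1\<close>.

  To leave the \<open>k\<close>-th rational hyperplane at step \<open>k\<close>, one needs a rational direction at \<open>x\<^sub>k\<close> along which
  the affine function defining it does not vanish identically near \<open>x\<^sub>k\<close>.  On \<open>Y\<close> that function is analytic and, by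
  connectedness, nowhere flat.  If it vanished along all rational directions, its leading form would vanish
  on a dense set of tangent directions, hence identically.  Only the C1 inverse function theorem is needed for the
  graph.  Avoiding in addition the points of a countable set gives uncountability.
\<close>

section \<open>Multivariate power series\<close>

definition mpow :: "real ^ 'm \<Rightarrow> ('m \<Rightarrow> nat) \<Rightarrow> real" where
  "mpow h \<alpha> = (\<Prod>i\<in>UNIV. (h $ i) ^ \<alpha> i)"

abbreviation mdeg :: "('m::finite \<Rightarrow> nat) \<Rightarrow> nat" where
  "mdeg \<alpha> \<equiv> sum \<alpha> UNIV"

text \<open>The codomain is arbitrary so that one notion serves both the chart maps and the scalar
  functions \<open>a \<bullet> \<psi> u - b\<close>. The radius refers to the sup norm.\<close>

definition power_series_at ::
    "(real ^ 'm \<Rightarrow> 'b::real_normed_vector) \<Rightarrow> real ^ 'm \<Rightarrow> real \<Rightarrow> (('m \<Rightarrow> nat) \<Rightarrow> 'b) \<Rightarrow> bool" where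
  "power_series_at F x r c \<longleftrightarrow> r > 0 \<and>
     (\<forall>h. (\<forall>i. \<bar>h $ i\<bar> < r) \<longrightarrow> ((\<lambda>\<alpha>. mpow h \<alpha> *\<^sub>R c \<alpha>) has_sum F (x + h)) UNIV)"

lemma real_analytic_on_iff_power_series:
  "real_analytic_on S F \<longleftrightarrow> open S \<and> (\<forall>x\<in>S. \<exists>r c. power_series_at F x r c)"
  unfolding real_analytic_on_def power_series_at_def mpow_def by blast

lemma mpow_scaleR: "mpow (t *\<^sub>R h) \<alpha> = t ^ mdeg \<alpha> * mpow h \<alpha>"
  by (simp add: mpow_def power_mult_distrib prod.distrib power_sum)

section \<open>Estimates for monomials and coefficients\<close>

lemma abs_mpow_le:
  assumes "\<And>i. \<bar>h $ i\<bar> \<le> M"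
  shows "\<bar>mpow h \<alpha>\<bar> \<le> M ^ mdeg \<alpha>"
proof -
  have "\<bar>mpow h \<alpha>\<bar> = (\<Prod>i\<in>UNIV. \<bar>h $ i\<bar> ^ \<alpha> i)"
    by (simp add: mpow_def abs_prod power_abs)
  also have "\<dots> \<le> (\<Prod>i\<in>UNIV. M ^ \<alpha> i)"
    by (intro prod_mono conjI power_mono assms) auto
  finally show ?thesis by (simp add: power_sum)
qed

text \<open>Scaling by \<open>1/M\<close> moves both points into the unit cube, where a difference
  of products of factors of size at most 1 is bounded by the sum of the differences of the factors.
  In degree 0 the truncated exponent is harmless, as the factor \<open>mdeg \<alpha>\<close>
  vanishes.\<close>

lemma abs_mpow_diff_le:
  assumes h: "\<And>i. \<bar>h $ i\<bar> \<le> M" and k: "\<And>i. \<bar>k $ i\<bar> \<le> M" and d: "\<And>i. \<bar>h $ i - k $ i\<bar> \<le> \<delta>" and "M > 0"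
  shows "\<bar>mpow h \<alpha> - mpow k \<alpha>\<bar> \<le> real (mdeg \<alpha>) * M ^ (mdeg \<alpha> - 1) * \<delta>"
proof -
  let ?h = "(1/M) *\<^sub>R h" and ?k = "(1/M) *\<^sub>R k"
  have hk: "mpow h \<alpha> - mpow k \<alpha> = M ^ mdeg \<alpha> * (mpow ?h \<alpha> - mpow ?k \<alpha>)"
    using \<open>M > 0\<close> by (simp add: mpow_scaleR power_divide right_diff_distrib)
  have h1: "norm (?h $ i) \<le> 1" and k1: "norm (?k $ i) \<le> 1" for i
    using h[of i] k[of i] \<open>M > 0\<close> by (simp_all add: abs_mult field_simps)
  have pw: "norm (z ^ n) \<le> 1" if "norm z \<le> 1" for z :: real and n
    unfolding norm_power using that by (intro power_le_one) auto
  have "norm (mpow ?h \<alpha> - mpow ?k \<alpha>) \<le> (\<Sum>i\<in>UNIV. norm ((?h $ i) ^ \<alpha> i - (?k $ i) ^ \<alpha> i))"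
    unfolding mpow_def by (intro norm_prod_diff pw h1 k1)
  also have "\<dots> \<le> (\<Sum>i\<in>UNIV. \<alpha> i * (\<delta> / M))"
  proof (rule sum_mono)
    fix i
    have "norm ((?h $ i) ^ \<alpha> i - (?k $ i) ^ \<alpha> i) \<le> \<alpha> i * norm (?h $ i - ?k $ i)"
      by (intro norm_power_diff h1 k1)
    also have "?h $ i - ?k $ i = (h $ i - k $ i) / M" by (simp add: diff_divide_distrib)
    also have "\<alpha> i * norm ((h $ i - k $ i) / M) \<le> \<alpha> i * (\<delta> / M)"
      using d[of i] \<open>M > 0\<close> by (intro mult_left_mono) (auto simp: divide_right_mono)
    finally show "norm ((?h $ i) ^ \<alpha> i - (?k $ i) ^ \<alpha> i) \<le> \<alpha> i * (\<delta> / M)" .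
  qed
  also have "\<dots> = real (mdeg \<alpha>) * (\<delta> / M)" by (simp only: sum_distrib_right[symmetric] of_nat_sum)
  finally have "\<bar>mpow h \<alpha> - mpow k \<alpha>\<bar> \<le> M ^ mdeg \<alpha> * (real (mdeg \<alpha>) * (\<delta> / M))"
    unfolding hk abs_mult using \<open>M > 0\<close> by (auto simp del: of_nat_sum times_divide_eq_right intro: mult_left_mono)
  also have "\<dots> = real (mdeg \<alpha>) * M ^ (mdeg \<alpha> - 1) * \<delta>"
    using \<open>M > 0\<close> by (cases "mdeg \<alpha>") (auto simp: field_simps)
  finally show ?thesis .
qed

lemma summable_on_sum_fun:
  fixes f :: "'i \<Rightarrow> 'a \<Rightarrow> 'b::{topological_comm_monoid_add}"
  assumes "\<And>i. i \<in> I \<Longrightarrow> f i summable_on A"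
  shows "(\<lambda>x. \<Sum>i\<in>I. f i x) summable_on A"
  using assms by (induction I rule: infinite_finite_induct) (auto intro: summable_on_add)

text \<open>At the diagonal point with all entries \<open>\<rho>\<close> every monomial equals
  \<open>\<rho> ^ mdeg \<alpha>\<close>. Unconditional convergence there is absolute in each real
  coordinate, and the l1 norm dominates the norm.\<close>

lemma power_series_at_coeffs_summable:
  fixes F :: "real ^ 'm \<Rightarrow> 'b::euclidean_space"
  assumes F: "power_series_at F x r c" and "0 < \<rho>" "\<rho> < r"
  shows "(\<lambda>\<alpha>. norm (c \<alpha>) * \<rho> ^ mdeg \<alpha>) summable_on UNIV"
proof -
  let ?h = "(\<chi> i. \<rho>) :: real ^ 'm"
  have mp: "mpow ?h \<alpha> = \<rho> ^ mdeg \<alpha>" for \<alpha> by (simp add: mpow_def power_sum)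
  have "((\<lambda>\<alpha>. mpow ?h \<alpha> *\<^sub>R c \<alpha>) has_sum F (x + ?h)) UNIV"
    using assms by (auto simp: power_series_at_def)
  then have s: "((\<lambda>\<alpha>. \<rho> ^ mdeg \<alpha> *\<^sub>R c \<alpha>) has_sum F (x + ?h)) UNIV" by (simp add: mp)
  have "((\<lambda>\<alpha>. (\<rho> ^ mdeg \<alpha> *\<^sub>R c \<alpha>) \<bullet> b) has_sum F (x + ?h) \<bullet> b) UNIV" for b
    using has_sum_bounded_linear[OF bounded_linear_inner_left s] by simp
  then have "(\<lambda>\<alpha>. \<bar>(\<rho> ^ mdeg \<alpha> *\<^sub>R c \<alpha>) \<bullet> b\<bar>) summable_on UNIV" for b
    using summable_on_iff_abs_summable_on_real[THEN iffD1, OF has_sum_imp_summable] by fastforce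
  then have S: "(\<lambda>\<alpha>. \<Sum>b\<in>Basis. \<bar>(\<rho> ^ mdeg \<alpha> *\<^sub>R c \<alpha>) \<bullet> b\<bar>) summable_on UNIV"
    by (intro summable_on_sum_fun) auto
  show ?thesis
  proof (rule summable_on_comparison_test[OF S])
    fix \<alpha> :: "'m \<Rightarrow> nat"
    have "norm (c \<alpha>) * \<rho> ^ mdeg \<alpha> = norm (\<rho> ^ mdeg \<alpha> *\<^sub>R c \<alpha>)" using \<open>0 < \<rho>\<close> by simp
    also have "\<dots> \<le> (\<Sum>b\<in>Basis. \<bar>(\<rho> ^ mdeg \<alpha> *\<^sub>R c \<alpha>) \<bullet> b\<bar>)" by (rule norm_le_l1)
    finally show "norm (c \<alpha>) * \<rho> ^ mdeg \<alpha> \<le> (\<Sum>b\<in>Basis. \<bar>(\<rho> ^ mdeg \<alpha> *\<^sub>R c \<alpha>) \<bullet> b\<bar>)" .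
  qed (use \<open>0 < \<rho>\<close> in auto)
qed

lemma finite_mdeg_eq: "finite {\<alpha> :: 'm::finite \<Rightarrow> nat. mdeg \<alpha> = m}"
proof (rule finite_subset)
  show "{\<alpha>. mdeg \<alpha> = m} \<subseteq> PiE UNIV (\<lambda>_. {..m})"
    by (auto simp: PiE_def intro: member_le_sum)
qed (auto intro: finite_PiE)

section \<open>Homogeneous parts and the Taylor remainder\<close>

definition hpart :: "(('m::finite \<Rightarrow> nat) \<Rightarrow> 'b::real_normed_vector) \<Rightarrow> nat \<Rightarrow> real ^ 'm \<Rightarrow> 'b" where
  "hpart c m h = (\<Sum>\<alpha> | mdeg \<alpha> = m. mpow h \<alpha> *\<^sub>R c \<alpha>)"

lemma hpart_scaleR: "hpart c m (t *\<^sub>R h) = t ^ m *\<^sub>R hpart c m h"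
  unfolding hpart_def scaleR_sum_right by (rule sum.cong) (auto simp: mpow_scaleR)

lemma continuous_on_hpart: "continuous_on S (hpart c m)"
  unfolding hpart_def mpow_def by (intro continuous_intros)

text \<open>An unconditional sum may be taken first within each degree; each degree class is finite,
  so the inner sums are the homogeneous parts.\<close>

lemma power_series_at_has_sum_hpart:
  fixes F :: "real ^ 'm \<Rightarrow> 'b::real_normed_vector"
  assumes "power_series_at F x r c" "\<And>i. \<bar>h $ i\<bar> < r"
  shows "((\<lambda>m. hpart c m h) has_sum F (x + h)) UNIV"
proof -
  let ?S = "Sigma UNIV (\<lambda>m. {\<alpha> :: 'm \<Rightarrow> nat. mdeg \<alpha> = m})"
  have bij: "bij_betw snd ?S UNIV" by (auto simp: bij_betw_def inj_on_def image_iff)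
  have "((\<lambda>\<alpha>. mpow h \<alpha> *\<^sub>R c \<alpha>) has_sum F (x + h)) UNIV"
    using assms by (auto simp: power_series_at_def)
  then have "((\<lambda>p. mpow h (snd p) *\<^sub>R c (snd p)) has_sum F (x + h)) ?S"
    using has_sum_reindex_bij_betw[OF bij, of "\<lambda>\<alpha>. mpow h \<alpha> *\<^sub>R c \<alpha>"] by simp
  then show ?thesis
    by (rule has_sum_SigmaD) (auto simp: hpart_def finite_mdeg_eq intro!: has_sum_finiteI)
qed

text \<open>Every term left in the tail has degree at least \<open>Suc m\<close>, and
  \<open>M / \<rho> \<le> 1\<close>, so its power can be lowered to exactly \<open>Suc m\<close>.
  The constant depends on neither \<open>h\<close> nor \<open>m\<close>, which makes the bound
  usable along a curve tending to \<open>x\<close>.\<close>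

lemma power_series_at_remainder:
  fixes F :: "real ^ 'm \<Rightarrow> 'b::euclidean_space"
  assumes F: "power_series_at F x r c" and "0 < \<rho>" "\<rho> < r"
    and h: "\<And>i. \<bar>h $ i\<bar> \<le> M" and "0 \<le> M" "M \<le> \<rho>"
  shows "norm (F (x + h) - (\<Sum>k\<le>m. hpart c k h)) \<le>
           (\<Sum>\<^sub>\<infinity>\<alpha>. norm (c \<alpha>) * \<rho> ^ mdeg \<alpha>) * (M / \<rho>) ^ Suc m"
proof -
  let ?A = "{\<alpha> :: 'm \<Rightarrow> nat. mdeg \<alpha> \<le> m}" and ?B = "\<lambda>\<alpha>. norm (c \<alpha>) * \<rho> ^ mdeg \<alpha>"
  have "?A = (\<Union>k\<le>m. {\<alpha>. mdeg \<alpha> = k})" by auto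
  then have fin: "finite ?A" and
    sm: "(\<Sum>k\<le>m. hpart c k h) = (\<Sum>\<alpha>\<in>?A. mpow h \<alpha> *\<^sub>R c \<alpha>)"
    unfolding hpart_def by (simp_all add: finite_mdeg_eq, subst sum.UNION_disjoint) (auto simp: finite_mdeg_eq)
  have s: "((\<lambda>\<alpha>. mpow h \<alpha> *\<^sub>R c \<alpha>) has_sum F (x + h)) UNIV"
    using F h \<open>M \<le> \<rho>\<close> \<open>\<rho> < r\<close> unfolding power_series_at_def by (meson le_less_trans)
  have "((\<lambda>\<alpha>. mpow h \<alpha> *\<^sub>R c \<alpha>) has_sum (\<Sum>k\<le>m. hpart c k h)) ?A"
    using fin by (auto simp: sm)
  from has_sum_Diff[OF s this]
  have D: "((\<lambda>\<alpha>. mpow h \<alpha> *\<^sub>R c \<alpha>) has_sum (F (x + h) - (\<Sum>k\<le>m. hpart c k h))) (UNIV - ?A)" by simp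
  have SB: "?B summable_on UNIV" using power_series_at_coeffs_summable[OF F] assms by auto
  then have SB': "?B summable_on (UNIV - ?A)" by (rule summable_on_subset_banach) auto
  have "norm (F (x + h) - (\<Sum>k\<le>m. hpart c k h)) \<le> infsum ?B (UNIV - ?A) * (M / \<rho>) ^ Suc m"
  proof (rule norm_infsum_le[OF D])
    show "((\<lambda>\<alpha>. ?B \<alpha> * (M / \<rho>) ^ Suc m) has_sum infsum ?B (UNIV - ?A) * (M / \<rho>) ^ Suc m) (UNIV - ?A)"
      by (intro has_sum_cmult_left has_sum_infsum SB')
    fix \<alpha> :: "'m \<Rightarrow> nat" assume "\<alpha> \<in> UNIV - ?A"
    then have deg: "Suc m \<le> mdeg \<alpha>" by auto
    have "norm (mpow h \<alpha> *\<^sub>R c \<alpha>) \<le> M ^ mdeg \<alpha> * norm (c \<alpha>)"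
      using abs_mpow_le[OF h, of \<alpha>] by (simp add: mult_right_mono)
    also have "M ^ mdeg \<alpha> = \<rho> ^ mdeg \<alpha> * (M / \<rho>) ^ mdeg \<alpha>" using \<open>0 < \<rho>\<close> by (simp add: power_divide)
    also have "\<dots> * norm (c \<alpha>) \<le> \<rho> ^ mdeg \<alpha> * (M / \<rho>) ^ Suc m * norm (c \<alpha>)"
      using assms deg by (intro mult_right_mono mult_left_mono power_decreasing) auto
    finally show "norm (mpow h \<alpha> *\<^sub>R c \<alpha>) \<le> ?B \<alpha> * (M / \<rho>) ^ Suc m" by (simp add: mult_ac)
  qed
  also have "\<dots> \<le> infsum ?B UNIV * (M / \<rho>) ^ Suc m"
    using assms by (intro mult_right_mono infsum_mono_neutral SB SB') auto
  finally show ?thesis .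
qed

section \<open>The linear part and C1 regularity\<close>

lemma hpart_1_eq:
  fixes c :: "('a::finite \<Rightarrow> nat) \<Rightarrow> 'b::real_normed_vector"
  shows "hpart c (Suc 0) h = (\<Sum>i\<in>UNIV. (h $ i) *\<^sub>R c (\<lambda>j. if j = i then 1 else 0))"
proof -
  let ?e = "\<lambda>i j :: 'a. if j = i then 1 else 0 :: nat"
  have "bij_betw ?e UNIV {\<alpha>. mdeg \<alpha> = Suc 0}"
  proof (rule bij_betwI')
    fix i j :: 'a show "(?e i = ?e j) = (i = j)" by (metis zero_neq_one)
    show "?e i \<in> {\<alpha>. mdeg \<alpha> = Suc 0}" by simp
  next
    fix \<alpha> :: "'a \<Rightarrow> nat" assume "\<alpha> \<in> {\<alpha>. mdeg \<alpha> = Suc 0}"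
    then obtain i where "\<alpha> i = Suc 0" "\<forall>j. j \<noteq> i \<longrightarrow> \<alpha> j = 0"
      by (auto simp: sum_eq_Suc0_iff)
    then show "\<exists>i\<in>UNIV. \<alpha> = ?e i" by (intro bexI[of _ i]) auto
  qed
  then have "hpart c (Suc 0) h = (\<Sum>i\<in>UNIV. mpow h (?e i) *\<^sub>R c (?e i))"
    unfolding hpart_def by (rule sum.reindex_bij_betw[symmetric])
  moreover have "mpow h (?e i) = h $ i" for i
    unfolding mpow_def by (subst prod.remove[of _ i]) auto
  ultimately show ?thesis by simp
qed

lemma linear_hpart_1: "linear (hpart c (Suc 0))"
  unfolding hpart_1_eq
  by (rule linearI) (simp_all add: scaleR_left_distrib sum.distrib scaleR_sum_right)

text \<open>Strict differentiability at every point: this is what makes the derivative continuous without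
  differentiating the series term by term.\<close>
lemma power_series_at_strict_derivative:
  fixes F :: "real ^ 'm \<Rightarrow> 'b::euclidean_space"
  assumes F: "power_series_at F x r c"
  obtains \<rho> C where "0 < \<rho>" "0 \<le> C"
    "\<And>h k. norm h \<le> \<rho> \<Longrightarrow> norm k \<le> \<rho> \<Longrightarrow>
       norm (F (x + h) - F (x + k) - hpart c (Suc 0) (h - k)) \<le> C * max (norm h) (norm k) * norm (h - k)"
proof -
  define \<rho> where "\<rho> = r / 2"
  have r: "0 < r" using F by (simp add: power_series_at_def)
  then have \<rho>: "0 < \<rho>" "\<rho> < r" by (auto simp: \<rho>_def)
  let ?B = "\<lambda>\<alpha>. norm (c \<alpha>) * \<rho> ^ mdeg \<alpha>"
  have SB: "?B summable_on UNIV" using power_series_at_coeffs_summable[OF F] \<rho> by auto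
  define S where "S = infsum ?B UNIV"
  have "0 \<le> S" unfolding S_def using \<rho> by (intro infsum_nonneg) auto
  \<comment> \<open>Halving the radius once more provides the factor \<open>1 / 2 ^ n\<close> that
    absorbs the factor \<open>n + 2\<close> coming from the difference of monomials of degree
    \<open>n + 2\<close>.\<close>
  have main: "norm (F (x + h) - F (x + k) - hpart c (Suc 0) (h - k)) \<le> 2 * S / \<rho>\<^sup>2 * max (norm h) (norm k) * norm (h - k)"
    if hk: "norm h \<le> \<rho> / 2" "norm k \<le> \<rho> / 2" for h k
  proof (cases "h = k")
    case True
    then show ?thesis using linear_0[OF linear_hpart_1, of c] by simp
  next
    case False
    define M where "M = max (norm h) (norm k)"
    have M: "0 < M" "M \<le> \<rho> / 2" using hk False unfolding M_def by (auto simp: less_max_iff_disj)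
    have hM: "\<bar>h $ i\<bar> \<le> M" and kM: "\<bar>k $ i\<bar> \<le> M" and dM: "\<bar>h $ i - k $ i\<bar> \<le> norm (h - k)" for i
      using component_le_norm_cart[of h i] component_le_norm_cart[of k i] component_le_norm_cart[of "h-k" i]
      unfolding M_def by auto
    have "\<bar>h $ i\<bar> < r" "\<bar>k $ i\<bar> < r" for i using hM[of i] kM[of i] M \<rho> by auto
    then have s: "((\<lambda>\<alpha>. mpow h \<alpha> *\<^sub>R c \<alpha>) has_sum F (x + h)) UNIV" "((\<lambda>\<alpha>. mpow k \<alpha> *\<^sub>R c \<alpha>) has_sum F (x + k)) UNIV"
      using F unfolding power_series_at_def by auto
    have s1: "((\<lambda>\<alpha>. (mpow h \<alpha> - mpow k \<alpha>) *\<^sub>R c \<alpha>) has_sum (F (x + h) - F (x + k))) UNIV"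
      using has_sum_add[OF s(1) has_sum_bounded_linear[OF bounded_linear_minus[OF bounded_linear_ident] s(2)]] by (simp add: scaleR_left_diff_distrib)
    \<comment> \<open>Among the terms of degree at most 1 the constants cancel and the linear form
      gives exactly \<open>hpart c (Suc 0) (h - k)\<close>; only degrees from 2 on contribute to the
      error.\<close>
    let ?A = "{\<alpha> :: 'm \<Rightarrow> nat. mdeg \<alpha> \<le> 1}"
    have "?A = {\<alpha>. mdeg \<alpha> = 0} \<union> {\<alpha>. mdeg \<alpha> = Suc 0}"
      by (auto simp: le_Suc_eq simp del: sum_eq_0_iff)
    then have fin: "finite ?A" and sm: "(\<Sum>\<alpha>\<in>?A. (mpow h \<alpha> - mpow k \<alpha>) *\<^sub>R c \<alpha>) =
      (hpart c 0 h - hpart c 0 k) + (hpart c (Suc 0) h - hpart c (Suc 0) k)"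
      by (simp_all only: finite_mdeg_eq finite_Un simp_thms, subst sum.union_disjoint)
         (auto simp: finite_mdeg_eq hpart_def scaleR_left_diff_distrib sum_subtractf simp del: sum_eq_0_iff)
    have "hpart c 0 h = hpart c 0 k" by (auto simp: hpart_def mpow_def intro!: sum.cong)
    then have sm: "(\<Sum>\<alpha>\<in>?A. (mpow h \<alpha> - mpow k \<alpha>) *\<^sub>R c \<alpha>) = hpart c (Suc 0) (h - k)"
      using sm linear_diff[OF linear_hpart_1, of c] by simp
    have "((\<lambda>\<alpha>. (mpow h \<alpha> - mpow k \<alpha>) *\<^sub>R c \<alpha>) has_sum hpart c (Suc 0) (h - k)) ?A"
      using fin by (auto simp flip: sm)
    from has_sum_Diff[OF s1 this]
    have D: "((\<lambda>\<alpha>. (mpow h \<alpha> - mpow k \<alpha>) *\<^sub>R c \<alpha>) has_sum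
         (F (x + h) - F (x + k) - hpart c (Suc 0) (h - k))) (UNIV - ?A)" by simp
    have SB': "?B summable_on (UNIV - ?A)" using SB by (rule summable_on_subset_banach) auto
    let ?K = "2 / \<rho>\<^sup>2 * M * norm (h - k)"
    have "norm (F (x + h) - F (x + k) - hpart c (Suc 0) (h - k)) \<le> infsum ?B (UNIV - ?A) * ?K"
    proof (rule norm_infsum_le[OF D])
      show "((\<lambda>\<alpha>. ?B \<alpha> * ?K) has_sum infsum ?B (UNIV - ?A) * ?K) (UNIV - ?A)"
        by (intro has_sum_cmult_left has_sum_infsum SB')
      fix \<alpha> :: "'m \<Rightarrow> nat" assume "\<alpha> \<in> UNIV - ?A"
      then obtain n where n: "mdeg \<alpha> = n + 2" by (metis Diff_iff UNIV_I add.commute le_Suc_ex mem_Collect_eq not_less_eq_eq numeral_2_eq_2 One_nat_def)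
      have "norm ((mpow h \<alpha> - mpow k \<alpha>) *\<^sub>R c \<alpha>) \<le> (real (mdeg \<alpha>) * M ^ (mdeg \<alpha> - 1) * norm (h - k)) * norm (c \<alpha>)"
        using abs_mpow_diff_le[OF hM kM dM M(1), of \<alpha>] by (simp add: mult_right_mono)
      also have "real (mdeg \<alpha>) * M ^ (mdeg \<alpha> - 1) = real (n + 2) * M ^ n * M"
        by (simp add: n)
      also have "\<dots> \<le> real (n + 2) * (\<rho> / 2) ^ n * M"
        using M by (intro mult_right_mono mult_left_mono power_mono) auto
      also have "\<dots> = (real (n + 2) / 2 ^ n) * \<rho> ^ n * M" by (simp add: power_divide)
      also have "\<dots> \<le> 2 * \<rho> ^ n * M"
      proof -
        have "real (n + 2) \<le> 2 * 2 ^ n"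
          by (induction n) auto
        then show ?thesis using M \<rho> by (intro mult_right_mono) (auto simp: field_simps)
      qed
      also have "2 * \<rho> ^ n * M = 2 / \<rho>\<^sup>2 * M * \<rho> ^ mdeg \<alpha>"
        using \<rho> by (simp add: n power_add power2_eq_square)
      finally show "norm ((mpow h \<alpha> - mpow k \<alpha>) *\<^sub>R c \<alpha>) \<le> ?B \<alpha> * ?K"
        by (simp add: mult_ac mult_left_mono mult_right_mono)
    qed
    also have "\<dots> \<le> S * ?K"
      unfolding S_def using M \<rho> by (intro mult_right_mono infsum_mono_neutral SB SB') auto
    finally show ?thesis unfolding M_def by (simp add: mult_ac)
  qed
  show ?thesis
    using main \<rho> \<open>0 \<le> S\<close> by (intro that[of "\<rho>/2" "2 * S / \<rho>\<^sup>2"]) auto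
qed

text \<open>The candidate derivative is the linear part of the series. The strict estimate with
  \<open>k = 0\<close> gives differentiability; comparing the estimates centred at two nearby points
  bounds the difference of their derivatives.\<close>

lemma real_analytic_on_C1:
  assumes "real_analytic_on S F"
  obtains F' where "\<And>x. x \<in> S \<Longrightarrow> (F has_derivative blinfun_apply (F' x)) (at x)" "continuous_on S F'"
proof -
  have "open S" using assms by (simp add: real_analytic_on_iff_power_series)
  have "\<exists>L \<rho> C. 0 < \<rho> \<and> 0 \<le> C \<and> (\<forall>h k. norm h \<le> \<rho> \<longrightarrow> norm k \<le> \<rho> \<longrightarrow>
       norm (F (x + h) - F (x + k) - blinfun_apply L (h - k)) \<le> C * max (norm h) (norm k) * norm (h - k))" if x: "x \<in> S" for x
  proof -
    obtain r c where ps: "power_series_at F x r c"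
      using assms x unfolding real_analytic_on_iff_power_series by blast
    have L: "blinfun_apply (Blinfun (hpart c (Suc 0))) = hpart c (Suc 0)"
      using linear_hpart_1[of c] by (simp add: bounded_linear_Blinfun_apply linear_conv_bounded_linear)
    show ?thesis
    proof (rule power_series_at_strict_derivative[OF ps])
      fix \<rho> C assume "0 < \<rho>" "0 \<le> C"
        "\<And>h k. norm h \<le> \<rho> \<Longrightarrow> norm k \<le> \<rho> \<Longrightarrow>
         norm (F (x + h) - F (x + k) - hpart c (Suc 0) (h - k)) \<le> C * max (norm h) (norm k) * norm (h - k)"
      then show ?thesis
        by (intro exI[of _ "Blinfun (hpart c (Suc 0))"] exI[of _ \<rho>] exI[of _ C]) (simp add: L)
    qed
  qed
  then obtain L \<rho> C where L: "\<And>x. x \<in> S \<Longrightarrow> 0 < \<rho> x" "\<And>x. x \<in> S \<Longrightarrow> 0 \<le> C x"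
    "\<And>x h k. x \<in> S \<Longrightarrow> norm h \<le> \<rho> x \<Longrightarrow> norm k \<le> \<rho> x \<Longrightarrow>
       norm (F (x + h) - F (x + k) - blinfun_apply (L x) (h - k)) \<le> C x * max (norm h) (norm k) * norm (h - k)"
    by metis
  have der: "(F has_derivative blinfun_apply (L x)) (at x)" if x: "x \<in> S" for x
    unfolding has_derivative_at
  proof (intro conjI)
    show "bounded_linear (blinfun_apply (L x))" by (rule blinfun.bounded_linear_right)
    show "(\<lambda>h. norm (F (x + h) - F x - blinfun_apply (L x) h) / norm h) \<midarrow>0\<rightarrow> 0"
    proof (rule tendsto_sandwich)
      show "\<forall>\<^sub>F h in at 0. 0 \<le> norm (F (x + h) - F x - blinfun_apply (L x) h) / norm h" by simp
      show "\<forall>\<^sub>F h in at 0. norm (F (x + h) - F x - blinfun_apply (L x) h) / norm h \<le> C x * norm h"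
        unfolding eventually_at
      proof (intro exI[of _ "\<rho> x"] conjI ballI impI L(1) x)
        fix h :: "real^'a" assume "h \<noteq> 0 \<and> dist h 0 < \<rho> x"
        then show "norm (F (x + h) - F x - blinfun_apply (L x) h) / norm h \<le> C x * norm h"
          using L(3)[OF x, of h 0] L(1)[OF x] by (simp add: field_simps)
      qed
      show "(\<lambda>h. C x * norm h) \<midarrow>0\<rightarrow> 0" by (auto intro!: tendsto_eq_intros)
    qed simp
  qed
  \<comment> \<open>The increment of \<open>F\<close> from \<open>x + k\<close> in direction
    \<open>t v\<close> is approximated both with centre \<open>x\<close> and with centre
    \<open>x + k\<close>. Subtracting, dividing by \<open>t\<close> and letting \<open>t\<close>
    tend to 0 from the right removes the term with the uncontrolled constant
    \<open>C (x + k)\<close>.\<close>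
  have near: "norm (L (x + k) - L x) \<le> C x * norm k" if x: "x \<in> S" "x + k \<in> S" "norm k < \<rho> x" for x k
  proof (rule norm_blinfun_bound)
    show "0 \<le> C x * norm k" using L(2)[OF x(1)] by simp
    fix v
    let ?g = "\<lambda>t. C (x + k) * t * (norm v)\<^sup>2 + C x * max (norm (k + t *\<^sub>R v)) (norm k) * norm v"
    have lim: "(?g \<longlongrightarrow> C (x + k) * 0 * (norm v)\<^sup>2 + C x * max (norm (k + 0 *\<^sub>R v)) (norm k) * norm v) (at_right 0)"
      by (intro tendsto_intros)
    have "((\<lambda>t. norm (k + t *\<^sub>R v)) \<longlongrightarrow> norm (k + 0 *\<^sub>R v)) (at_right 0)" by (intro tendsto_intros)
    then have ev1: "\<forall>\<^sub>F t in at_right 0. norm (k + t *\<^sub>R v) < \<rho> x"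
      using x(3) by (intro order_tendstoD) auto
    have "((\<lambda>t. norm (t *\<^sub>R v)) \<longlongrightarrow> norm (0 *\<^sub>R v)) (at_right 0)" by (intro tendsto_intros)
    then have ev2: "\<forall>\<^sub>F t in at_right 0. norm (t *\<^sub>R v) < \<rho> (x + k)"
      using L(1)[OF x(2)] by (intro order_tendstoD) auto
    have "norm (blinfun_apply (L (x + k) - L x) v) \<le> C (x + k) * 0 * (norm v)\<^sup>2 + C x * max (norm (k + 0 *\<^sub>R v)) (norm k) * norm v"
    proof (rule tendsto_lowerbound[OF lim])
      show "\<forall>\<^sub>F t in at_right 0. norm (blinfun_apply (L (x + k) - L x) v) \<le> ?g t"
        using ev1 ev2 eventually_at_right_less[of 0]
      proof eventually_elim
        case (elim t)
        let ?d = "F (x + k + t *\<^sub>R v) - F (x + k)"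
        have "norm (?d - t *\<^sub>R blinfun_apply (L x) v) \<le>
            C x * max (norm (k + t *\<^sub>R v)) (norm k) * (t * norm v)"
          using L(3)[OF x(1), of "k + t *\<^sub>R v" k] elim x(3) by (simp add: add.assoc blinfun.scaleR_right)
        moreover have "norm (?d - t *\<^sub>R blinfun_apply (L (x + k)) v) \<le> C (x + k) * (t * norm v) * (t * norm v)"
          using L(3)[OF x(2), of "t *\<^sub>R v" 0] L(1)[OF x(2)] elim by (simp add: blinfun.scaleR_right)
        moreover have "t *\<^sub>R blinfun_apply (L (x + k) - L x) v =
            (?d - t *\<^sub>R blinfun_apply (L x) v) - (?d - t *\<^sub>R blinfun_apply (L (x + k)) v)"
          by (simp add: blinfun.diff_left algebra_simps)
        ultimately have "norm (t *\<^sub>R blinfun_apply (L (x + k) - L x) v) \<le>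
            C x * max (norm (k + t *\<^sub>R v)) (norm k) * (t * norm v) + C (x + k) * (t * norm v) * (t * norm v)"
          using order_trans[OF norm_triangle_ineq4 add_mono] by (simp only:)
        also have "\<dots> = t * ?g t" by (simp add: power2_eq_square algebra_simps)
        finally show ?case using elim by simp
      qed
    qed simp
    then show "norm (blinfun_apply (L (x + k) - L x) v) \<le> C x * norm k * norm v"
      by simp
  qed
  have "continuous_on S L"
    unfolding continuous_on_eq_continuous_at[OF \<open>open S\<close>]
  proof
    fix x assume x: "x \<in> S"
    obtain e where e: "e > 0" "ball x e \<subseteq> S" using \<open>open S\<close> x openE by blast
    show "isCont L x"
      unfolding isCont_def
    proof (rule LIM_zero_cancel, rule tendsto_norm_zero_cancel, rule tendsto_sandwich)
      show "\<forall>\<^sub>F y in at x. 0 \<le> norm (L y - L x)" by simp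
      show "\<forall>\<^sub>F y in at x. norm (L y - L x) \<le> C x * norm (y - x)"
        unfolding eventually_at
      proof (intro exI[of _ "min e (\<rho> x)"] conjI ballI impI)
        fix y assume "y \<noteq> x \<and> dist y x < min e (\<rho> x)"
        then show "norm (L y - L x) \<le> C x * norm (y - x)"
          using near[of x "y - x"] x e by (auto simp: dist_norm norm_minus_commute subset_iff)
      qed (use e L(1)[OF x] in auto)
      show "(\<lambda>y. C x * norm (y - x)) \<midarrow>x\<rightarrow> 0" by (auto intro!: tendsto_eq_intros)
    qed simp
  qed
  with der show ?thesis by (rule that)
qed

section \<open>Zeros of analytic functions\<close>

text \<open>The expansion is at 0 but the zeros accumulate at 1, so the series is extended to the
  complex disc of radius \<open>R > 1\<close>, which contains 1, and the identity theorem
  applies.\<close>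

lemma powser_eq_0_near_1:
  fixes a :: "nat \<Rightarrow> real"
  assumes "R > 1" and sm: "\<And>\<tau>. \<bar>\<tau>\<bar> < R \<Longrightarrow> (\<lambda>m. a m * \<tau> ^ m) sums s \<tau>"
    and "\<epsilon> > 0" and z: "\<And>\<tau>. \<bar>\<tau> - 1\<bar> < \<epsilon> \<Longrightarrow> s \<tau> = 0"
  shows "a m = 0"
proof -
  define A where "A n = complex_of_real (a n)" for n
  define f where "f z = (\<Sum>n. A n * z ^ n)" for z
  have sums: "(\<lambda>n. A n * z ^ n) sums f z" if zR: "cmod z < R" for z
  proof -
    obtain \<rho> where \<rho>: "cmod z < \<rho>" "\<rho> < R" using zR dense by blast
    then have "\<bar>\<rho>\<bar> < R" using norm_ge_zero[of z] by linarith
    then have "summable (\<lambda>n. complex_of_real (a n * \<rho> ^ n))"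
      using sm sums_summable summable_of_real by blast
    then have "summable (\<lambda>n. A n * complex_of_real \<rho> ^ n)" by (simp add: A_def)
    then have "summable (\<lambda>n. A n * z ^ n)"
      by (rule powser_inside) (use \<rho> norm_ge_zero[of z] in auto)
    then show ?thesis by (simp add: f_def summable_sums)
  qed
  have holf: "f holomorphic_on ball 0 R"
    by (rule power_series_holomorphic[of 0 R A]) (use sums in \<open>auto simp: dist_norm\<close>)
  let ?U = "complex_of_real ` {\<tau>. \<bar>\<tau> - 1\<bar> < min \<epsilon> (R - 1)}"
  have U: "?U \<subseteq> ball 0 R" by auto
  have lim: "1 islimpt ?U"
    unfolding islimpt_approachable
  proof (intro allI impI)
    fix e :: real assume "e > 0"
    define \<tau> where "\<tau> = 1 + min e (min \<epsilon> (R - 1)) / 2"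
    have "0 < \<tau> - 1" "\<tau> - 1 < min e (min \<epsilon> (R - 1))" using \<open>e > 0\<close> assms by (auto simp: \<tau>_def)
    moreover have "dist (complex_of_real \<tau>) 1 = \<bar>\<tau> - 1\<bar>"
      by (metis dist_of_real dist_real_def of_real_1)
    ultimately have "complex_of_real \<tau> \<in> ?U" "dist (complex_of_real \<tau>) 1 < e" "complex_of_real \<tau> \<noteq> 1"
      by (auto intro!: imageI)
    then show "\<exists>x'\<in>?U. x' \<noteq> 1 \<and> dist x' 1 < e" by blast
  qed
  have fU: "f z = 0" if "z \<in> ?U" for z
  proof -
    obtain \<tau> where \<tau>: "z = complex_of_real \<tau>" "\<bar>\<tau> - 1\<bar> < min \<epsilon> (R - 1)" using \<open>z \<in> ?U\<close> by auto
    then have "(\<lambda>n. complex_of_real (a n * \<tau> ^ n)) sums complex_of_real (s \<tau>)"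
      by (intro sums_of_real sm) auto
    then have "(\<lambda>n. A n * z ^ n) sums 0" using z \<tau> by (simp add: A_def)
    moreover have "(\<lambda>n. A n * z ^ n) sums f z" using sums U \<open>z \<in> ?U\<close> by (force simp: dist_norm)
    ultimately show ?thesis using sums_unique2 by blast
  qed
  have f0: "f z = 0" if "cmod z < R" for z
    by (rule analytic_continuation[OF holf open_ball connected_ball U _ lim fU]) (use that \<open>R > 1\<close> in auto)
  \<comment> \<open>The constant coefficient is the value at 0. A nonzero coefficient of positive
    degree would make 0 an isolated zero, although \<open>f\<close> vanishes on the whole
    disc.\<close>
  have "A m = 0"
  proof (cases "m = 0")
    case True
    have "(\<lambda>n. A n * 0 ^ n) sums 0" using sums[of 0] f0[of 0] \<open>R > 1\<close> by simp
    then show ?thesis using True by simp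
  next
    case False
    show ?thesis
    proof (rule ccontr)
      assume "A m \<noteq> 0"
      obtain s' where "0 < s'" and nz: "\<And>z. z \<in> cball 0 s' - {0} \<Longrightarrow> f z \<noteq> 0"
        by (rule powser_0_nonzero[of R 0 A f m]) (use sums f0 \<open>A m \<noteq> 0\<close> False \<open>R > 1\<close> in auto)
      moreover have "f (complex_of_real (min s' (R / 2))) = 0"
        using \<open>0 < s'\<close> \<open>R > 1\<close> by (intro f0) auto
      ultimately show False
        using \<open>R > 1\<close> by (auto simp: min_def split: if_splits)
    qed
  qed
  then show ?thesis by (simp add: A_def)
qed

section \<open>Vanishing along rays and leading forms\<close>

lemma real_polynomial_function_eq_0_near_0:
  fixes p :: "real \<Rightarrow> real"
  assumes "real_polynomial_function p" "\<epsilon> > 0" "\<And>t. \<bar>t\<bar> < \<epsilon> \<Longrightarrow> p t = 0"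
  shows "p t = 0"
proof -
  obtain a n where p: "p = (\<lambda>x. \<Sum>i\<le>n. a i * x ^ i)" using real_polynomial_function_imp_sum assms(1) by blast
  have "infinite {x. p x = 0}"
  proof -
    have "{-\<epsilon><..<\<epsilon>} \<subseteq> {x. p x = 0}" using assms(3) by (auto simp: abs_less_iff)
    then show ?thesis using infinite_super infinite_Ioo[of "-\<epsilon>" \<epsilon>] \<open>\<epsilon> > 0\<close> by (metis less_trans neg_less_0_iff_less)
  qed
  then have "\<forall>i\<le>n. a i = 0" using Transcendental.polyfun_roots_finite[of a _ n] by (auto simp: p)
  then show ?thesis by (simp add: p)
qed

lemma real_polynomial_function_hpart_line:
  fixes c :: "('m::finite \<Rightarrow> nat) \<Rightarrow> real"
  shows "real_polynomial_function (\<lambda>t. hpart c m (z + t *\<^sub>R w))"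
proof -
  have "real_polynomial_function (\<lambda>t::real. z $ i + t * w $ i)" for i
    by (rule real_polynomial_function.intros(3)[OF real_polynomial_function.intros(2)
          real_polynomial_function.intros(1)[OF bounded_linear_mult_left]])
  then have "real_polynomial_function (\<lambda>t::real. \<Prod>i\<in>UNIV. (z $ i + t * w $ i) ^ \<alpha> i)" for \<alpha>
    by (intro real_polynomial_function_prod real_polynomial_function_power) auto
  then show ?thesis
    unfolding hpart_def mpow_def real_scaleR_def
    by (auto intro!: real_polynomial_function_sum finite_mdeg_eq real_polynomial_function.intros(2,4))
qed

text \<open>On the ray through \<open>z\<close> the series is a power series in one variable that vanishes near \<open>1\<close>, so each
  homogeneous part vanishes at \<open>z\<close> and, likewise, at all points of \<open>L\<close> near \<open>z\<close>.\<close>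
lemma hpart_eq_0_if_eq_0_near:
  fixes h :: "real ^ 'm \<Rightarrow> real"
  assumes ps: "power_series_at h u r c" and L: "subspace L" and z: "z \<in> L" "\<And>i. \<bar>z $ i\<bar> < r"
    and N: "open N" "z \<in> N" "\<And>z'. z' \<in> L \<Longrightarrow> z' \<in> N \<Longrightarrow> h (u + z') = 0" and w: "w \<in> L"
  shows "hpart c m w = 0"
proof -
  have r: "r > 0" using ps by (simp add: power_series_at_def)
  have step: "hpart c m z' = 0" if z': "z' \<in> L" "z' \<in> N" "\<And>i. \<bar>z' $ i\<bar> < r" for z'
  proof -
    \<comment> \<open>\<open>M\<close> bounds the entries of \<open>z'\<close>; including
      \<open>r / 2\<close> keeps it positive when \<open>z' = 0\<close>. The series in
      \<open>\<tau>\<close> then converges for \<open>\<bar>\<tau>\<bar> < r / M\<close>, a radius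
      beyond 1.\<close>
    define M where "M = max (r / 2) (Max (range (\<lambda>i. \<bar>z' $ i\<bar>)))"
    have "Max (range (\<lambda>i. \<bar>z' $ i\<bar>)) < r" using z'(3) by (subst Max_less_iff) auto
    then have M: "0 < M" "M < r" using r by (auto simp: M_def)
    have zM: "\<bar>z' $ i\<bar> \<le> M" for i
      unfolding M_def by (rule order_trans[OF Max_ge max.cobounded2]) auto
    have "\<exists>e>0. \<forall>\<tau>. dist \<tau> 1 < e \<longrightarrow> \<tau> *\<^sub>R z' \<in> N"
    proof -
      have "open ((\<lambda>\<tau>. \<tau> *\<^sub>R z') -` N)" by (intro open_vimage N(1) continuous_intros)
      moreover have "1 \<in> (\<lambda>\<tau>. \<tau> *\<^sub>R z') -` N" using z'(2) by simp
      ultimately show ?thesis unfolding open_dist by (metis vimageD)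
    qed
    then obtain e where e: "e > 0" "\<And>\<tau>. \<bar>\<tau> - 1\<bar> < e \<Longrightarrow> \<tau> *\<^sub>R z' \<in> N" by (auto simp: dist_real_def)
    show ?thesis
    proof (rule powser_eq_0_near_1[of "r / M" _ "\<lambda>\<tau>. h (u + \<tau> *\<^sub>R z')" e])
      show "1 < r / M" using M by simp
      fix \<tau> assume \<tau>: "\<bar>\<tau>\<bar> < r / M"
      have "\<bar>(\<tau> *\<^sub>R z') $ i\<bar> < r" for i
      proof -
        have "\<bar>(\<tau> *\<^sub>R z') $ i\<bar> \<le> \<bar>\<tau>\<bar> * M" using zM[of i] by (simp add: abs_mult mult_left_mono)
        also have "\<dots> < r" using \<tau> M by (simp add: field_simps)
        finally show ?thesis .
      qed
      from has_sum_imp_sums[OF power_series_at_has_sum_hpart[OF ps this]]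
      show "(\<lambda>m. hpart c m z' * \<tau> ^ m) sums h (u + \<tau> *\<^sub>R z')" by (simp add: hpart_scaleR mult.commute)
    next
      fix \<tau> assume "\<bar>\<tau> - 1\<bar> < e"
      then show "h (u + \<tau> *\<^sub>R z') = 0" using N(3) e(2) L z'(1) by (simp add: subspace_scale)
    qed (use e in auto)
  qed
  let ?N = "N \<inter> {z'. \<forall>i. \<bar>z' $ i\<bar> < r}"
  have "open {z' :: real ^ 'm. \<forall>i. \<bar>z' $ i\<bar> < r}"
    unfolding Collect_all_eq by (intro open_INT ballI open_Collect_less continuous_intros) auto
  then have "open ?N" using N(1) by blast
  then have "open ((\<lambda>t. z + t *\<^sub>R (w - z)) -` ?N)" by (intro open_vimage continuous_intros)
  moreover have "0 \<in> (\<lambda>t. z + t *\<^sub>R (w - z)) -` ?N" using z N by simp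
  ultimately have "\<exists>e>0. \<forall>t. dist t 0 < e \<longrightarrow> t \<in> (\<lambda>t. z + t *\<^sub>R (w - z)) -` ?N"
    unfolding open_dist by blast
  then obtain e where e: "e > 0" "\<And>t. \<bar>t\<bar> < e \<Longrightarrow> z + t *\<^sub>R (w - z) \<in> ?N" by auto
  \<comment> \<open>Along the line from \<open>z\<close> to \<open>w\<close> the homogeneous part is
    a polynomial in \<open>t\<close>; it vanishes for small \<open>t\<close>, hence also at
    \<open>t = 1\<close>, which is \<open>w\<close>.\<close>
  have "hpart c m (z + 1 *\<^sub>R (w - z)) = 0"
  proof (rule real_polynomial_function_eq_0_near_0[OF real_polynomial_function_hpart_line e(1)])
    fix t assume "\<bar>t\<bar> < e"
    then show "hpart c m (z + t *\<^sub>R (w - z)) = 0"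
      using e(2)[of t] L z(1) w by (intro step) (auto intro!: subspace_add subspace_scale subspace_diff)
  qed
  then show ?thesis by simp
qed

lemma power_series_at_eq_0:
  assumes "power_series_at h u r c" "\<And>i. \<bar>w $ i\<bar> < r" "\<And>m. hpart c m w = 0"
  shows "h (u + w) = 0"
proof -
  have "((\<lambda>m. 0) has_sum h (u + w)) (UNIV :: nat set)"
    using power_series_at_has_sum_hpart[OF assms(1,2)] assms(3) by simp
  then show ?thesis using has_sum_unique has_sum_0_simp by blast
qed

text \<open>Along \<open>\<gamma>\<close> the parts below degree \<open>m\<close> drop out because
  the displacement stays in \<open>L\<close>, so \<open>0 = h (\<gamma> t)\<close> is
  \<open>t ^ m\<close> times the degree \<open>m\<close> part at the difference quotient, up to an
  error of order \<open>t ^ Suc m\<close>. Dividing by \<open>t ^ m\<close> gives the claim in the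
  limit.\<close>

lemma leading_form_eq_0:
  fixes h :: "real ^ 'm \<Rightarrow> real"
  assumes ps: "power_series_at h u r c"
    and lower: "\<And>k w. k < m \<Longrightarrow> w \<in> L \<Longrightarrow> hpart c k w = 0"
    and ev: "\<forall>\<^sub>F t in at 0. \<gamma> t - u \<in> L \<and> h (\<gamma> t) = 0"
    and v: "((\<lambda>t. (\<gamma> t - u) /\<^sub>R t) \<longlongrightarrow> v) (at 0)"
  shows "hpart c m v = 0"
proof -
  define \<rho> where "\<rho> = r / 2"
  have \<rho>: "0 < \<rho>" "\<rho> < r" using ps by (auto simp: \<rho>_def power_series_at_def)
  define B where "B = (\<Sum>\<^sub>\<infinity>\<alpha>. norm (c \<alpha>) * \<rho> ^ mdeg \<alpha>)"
  let ?q = "\<lambda>t. (\<gamma> t - u) /\<^sub>R t"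
  have lim: "((\<lambda>t. hpart c m (?q t)) \<longlongrightarrow> hpart c m v) (at 0)"
    by (rule isCont_tendsto_compose[OF _ v]) (use continuous_on_hpart[of UNIV c m] in \<open>simp add: continuous_on_eq_continuous_at\<close>)
  have "((\<lambda>t. t *\<^sub>R ?q t) \<longlongrightarrow> 0 *\<^sub>R v) (at 0)" by (intro tendsto_intros v)
  then have "((\<lambda>t. norm (t *\<^sub>R ?q t)) \<longlongrightarrow> norm (0 *\<^sub>R v)) (at 0)" by (rule tendsto_norm)
  then have ev2: "\<forall>\<^sub>F t in at 0. norm (t *\<^sub>R ?q t) < \<rho>" using \<rho> by (intro order_tendstoD) auto
  have ev3: "\<forall>\<^sub>F t in at 0. t \<noteq> (0::real)" by (simp add: eventually_at_filter)
  have "((\<lambda>t. hpart c m (?q t)) \<longlongrightarrow> 0) (at 0)"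
  proof (rule Lim_null_comparison)
    have "((\<lambda>t. B * \<bar>t\<bar> * (norm (?q t) / \<rho>) ^ Suc m) \<longlongrightarrow> B * \<bar>0\<bar> * (norm v / \<rho>) ^ Suc m) (at 0)"
      by (intro tendsto_intros v) (use \<rho> in auto)
    then show "((\<lambda>t. B * \<bar>t\<bar> * (norm (?q t) / \<rho>) ^ Suc m) \<longlongrightarrow> 0) (at 0)" by simp
    show "\<forall>\<^sub>F t in at 0. norm (hpart c m (?q t)) \<le> B * \<bar>t\<bar> * (norm (?q t) / \<rho>) ^ Suc m"
      using ev ev2 ev3
    proof eventually_elim
      case (elim t)
      let ?w = "\<gamma> t - u"
      have tq: "t *\<^sub>R ?q t = ?w" using elim by simp
      have "norm (h (u + ?w) - (\<Sum>k\<le>m. hpart c k ?w)) \<le> B * (norm ?w / \<rho>) ^ Suc m"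
        unfolding B_def using elim tq
        by (intro power_series_at_remainder[OF ps \<rho>] component_le_norm_cart) auto
      moreover have "(\<Sum>k\<le>m. hpart c k ?w) = hpart c m ?w"
        using lower elim by (subst sum.mono_neutral_right[of _ "{m}"]) auto
      ultimately have "norm (hpart c m ?w) \<le> B * (norm ?w / \<rho>) ^ Suc m" using elim by simp
      moreover have "hpart c m ?w = t ^ m * hpart c m (?q t)"
        using hpart_scaleR[of c m t "?q t"] tq by simp
      moreover have "norm ?w = \<bar>t\<bar> * norm (?q t)" using tq by (metis norm_scaleR)
      ultimately have "norm (t ^ m * hpart c m (?q t)) \<le> B * (\<bar>t\<bar> * norm (?q t) / \<rho>) ^ Suc m"
        by (simp only:)
      also have "\<dots> = \<bar>t\<bar> ^ m * (B * \<bar>t\<bar> * (norm (?q t) / \<rho>) ^ Suc m)"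
        by (simp only: power_mult_distrib power_Suc times_divide_eq_right[symmetric] mult_ac)
      finally have "\<bar>t\<bar> ^ m * norm (hpart c m (?q t)) \<le> \<bar>t\<bar> ^ m * (B * \<bar>t\<bar> * (norm (?q t) / \<rho>) ^ Suc m)"
        by (simp only: abs_mult power_abs real_norm_def)
      moreover have "0 < \<bar>t\<bar> ^ m" using elim by simp
      ultimately show ?case by (rule mult_left_le_imp_le)
    qed
  qed
  then show ?thesis using LIM_unique lim by blast
qed

section \<open>Rational lines and the nested construction\<close>

definition coord_space :: "'n::finite set \<Rightarrow> (real ^ 'n) set" where
  "coord_space J = {x. \<forall>i. i \<notin> J \<longrightarrow> x $ i = 0}"

lemma subspace_coord_space: "subspace (coord_space J)"
  by (auto simp: subspace_def coord_space_def)

lemma axis_in_coord_space: "j \<in> J \<Longrightarrow> axis j a \<in> coord_space J"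
  by (auto simp: coord_space_def axis_def)

lemma common_denominator:
  assumes "finite S" "S \<subseteq> (\<rat> :: real set)"
  obtains N :: nat where "N > 0" "\<And>s. s \<in> S \<Longrightarrow> real N * s \<in> \<int>"
proof -
  have "\<exists>N::nat. N > 0 \<and> (\<forall>s\<in>S. real N * s \<in> \<int>)"
    using assms
  proof (induction S rule: finite_induct)
    case (insert a S)
    then obtain N :: nat where N: "N > 0" "\<forall>s\<in>S. real N * s \<in> \<int>" by auto
    from insert obtain m n :: int where mn: "n > 0" "a = of_int m / of_int n" by (auto elim: Rats_cases')
    have "real (N * nat n) * s \<in> \<int>" if "s \<in> insert a S" for s
    proof (cases "s = a")
      case True
      then have "real (N * nat n) * s = of_int (int N * m)" using mn by simp
      then show ?thesis by (metis Ints_of_int)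
    next
      case False
      then have "real N * s * of_int n \<in> \<int>" using N that by (intro Ints_mult[of "real N * s"]) auto
      then show ?thesis using mn by (simp only: of_nat_mult of_nat_nat mult_ac less_imp_le)
    qed
    then show ?case using N mn by (intro exI[of _ "N * nat n"]) auto
  qed auto
  then show ?thesis using that by blast
qed

lemma independent_coordinatewise:
  fixes S :: "(real ^ 'n) set"
  assumes "\<And>a. a \<in> S \<Longrightarrow> \<exists>j. a $ j \<noteq> 0 \<and> (\<forall>b\<in>S - {a}. b $ j = 0)"
  shows "independent S"
  unfolding dependent_def
proof
  assume "\<exists>a\<in>S. a \<in> span (S - {a})"
  then obtain a where a: "a \<in> S" "a \<in> span (S - {a})" by blast
  obtain j where j: "a $ j \<noteq> 0" "\<forall>b\<in>S - {a}. b $ j = 0" using assms a(1) by blast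
  have "span (S - {a}) \<subseteq> {b. b $ j = 0}"
    using j(2) by (intro span_minimal) (auto simp: subspace_def)
  then show False using a j by auto
qed

text \<open>The equations hold exactly at \<open>x\<close>, and \<open>T\<close> bounds their size.
  Support in \<open>J\<close> makes their left-hand sides depend on the coordinates in
  \<open>J\<close> only, so that they survive the passage to the graph.\<close>

definition integer_system ::
    "'n::finite set \<Rightarrow> nat \<Rightarrow> real \<Rightarrow> (nat \<Rightarrow> real ^ 'n) \<Rightarrow> (nat \<Rightarrow> int) \<Rightarrow> real ^ 'n \<Rightarrow> bool" where
  "integer_system J g T q p x \<longleftrightarrow> inj_on q {1..g} \<and> independent (q ` {1..g}) \<and>
     (\<forall>i\<in>{1..g}. integer_vec (q i) \<and> q i \<in> coord_space J \<and> infnorm (q i) \<le> T \<and> q i \<bullet> x = of_int (p i))"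

text \<open>With \<open>v $ j0 \<noteq> 0\<close>, the vectors
  \<open>v $ j0 *\<^sub>R axis k 1 - v $ k *\<^sub>R axis j0 1\<close> are orthogonal to
  \<open>v\<close>, so each takes a constant value on the line. There are \<open>card J - 1\<close>
  choices of \<open>k\<close> in \<open>J\<close> other than \<open>j0\<close>, which is where
  \<open>g < card J\<close> enters.\<close>

lemma rational_line_integer_system:
  fixes x v :: "real ^ 'n"
  assumes x: "rational_vec x" and v: "rational_vec v" "v \<in> coord_space J" "v \<noteq> 0" and g: "g < card J"
  obtains q p T where "\<And>\<tau>. integer_system J g T q p (x + \<tau> *\<^sub>R v)"
proof -
  obtain j0 where j0: "v $ j0 \<noteq> 0" using v(3) by (auto simp: vec_eq_iff)
  then have "j0 \<in> J" using v(2) by (auto simp: coord_space_def)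
  then have "card {1..g} \<le> card (J - {j0})" using g by simp
  then obtain j where j: "j ` {1..g} \<subseteq> J - {j0}" "inj_on j {1..g}"
    using card_le_inj[of "{1..g}" "J - {j0}"] by auto
  define u where "u k = v $ j0 *\<^sub>R axis k 1 - v $ k *\<^sub>R (axis j0 1 :: real ^ 'n)" for k
  have u_nth: "u k $ i = (if i = k then v $ j0 else 0) - (if i = j0 then v $ k else 0)" for k i
    by (simp add: u_def axis_def)
  have uv: "u k \<bullet> v = 0" for k
    by (simp add: u_def inner_diff_left inner_axis')
  have vQ: "v $ i \<in> \<rat>" and xQ: "x $ i \<in> \<rat>" for i using x v by (auto simp: rational_vec_def)
  then have uQ: "u k $ i \<in> \<rat>" for k i by (simp add: u_nth)
  have uxQ: "u k \<bullet> x \<in> \<rat>" for k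
    by (simp add: u_def inner_diff_left inner_axis' vQ xQ)
  \<comment> \<open>One denominator is cleared for all entries and for all values at
    \<open>x\<close>, so both sides of every equation become integers.\<close>
  obtain N :: nat where N: "N > 0"
    "\<And>s. s \<in> range (\<lambda>(k, i). u k $ i) \<union> range (\<lambda>k. u k \<bullet> x) \<Longrightarrow> real N * s \<in> \<int>"
    by (rule common_denominator[of "range (\<lambda>(k, i). u k $ i) \<union> range (\<lambda>k. u k \<bullet> x)"]) (use uQ uxQ in auto)
  define q where "q i = real N *\<^sub>R u (j i)" for i
  define p where "p i = \<lfloor>q i \<bullet> x\<rfloor>" for i
  define T where "T = (\<Sum>i\<in>{1..g}. infnorm (q i))"
  \<comment> \<open>The coordinate \<open>j i\<close> differs from \<open>j0\<close> and, among the
    chosen vectors, is nonzero in \<open>q i\<close> only; this yields both injectivity and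
    independence.\<close>
  have qv: "q i $ (j i') = (if i = i' then real N * v $ j0 else 0)" if "i \<in> {1..g}" "i' \<in> {1..g}" for i i'
  proof -
    have "j i' \<in> J - {j0}" using j(1) that(2) by blast
    moreover have "j i' = j i \<longleftrightarrow> i = i'" using j that by (auto dest: inj_onD)
    ultimately show ?thesis by (simp add: q_def u_nth)
  qed
  have inj: "inj_on q {1..g}"
  proof (rule inj_onI)
    fix i i' assume i: "i \<in> {1..g}" "i' \<in> {1..g}" "q i = q i'"
    have "q i $ (j i) \<noteq> 0" using qv[OF i(1,1)] N j0 by simp
    then have "q i' $ (j i) \<noteq> 0" by (metis i(3))
    then show "i = i'" using qv[OF i(2,1)] by metis
  qed
  have "independent (q ` {1..g})"
  proof (rule independent_coordinatewise)
    fix a assume "a \<in> q ` {1..g}"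
    then obtain i where i: "i \<in> {1..g}" "a = q i" by blast
    have "\<forall>b\<in>q ` {1..g} - {a}. b $ (j i) = 0" using i qv by (auto split: if_splits)
    moreover have "a $ (j i) \<noteq> 0" using i qv N j0 by simp
    ultimately show "\<exists>j. a $ j \<noteq> 0 \<and> (\<forall>b\<in>q ` {1..g} - {a}. b $ j = 0)" by blast
  qed
  moreover have "integer_vec (q i)" for i using N(2) by (auto simp: integer_vec_def q_def)
  moreover have "q i \<in> coord_space J" if "i \<in> {1..g}" for i
  proof -
    have "j i \<in> J" using j(1) that by blast
    then show ?thesis using \<open>j0 \<in> J\<close> by (auto simp: coord_space_def q_def u_nth)
  qed
  moreover have "infnorm (q i) \<le> T" if "i \<in> {1..g}" for i
    unfolding T_def using that by (intro member_le_sum) (auto simp: infnorm_pos_le)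
  moreover have "q i \<bullet> (x + \<tau> *\<^sub>R v) = of_int (p i)" for i \<tau>
  proof -
    have "q i \<bullet> (x + \<tau> *\<^sub>R v) = q i \<bullet> x" using uv by (simp add: q_def inner_add_right)
    moreover have "q i \<bullet> x \<in> \<int>" using N(2) by (auto simp: q_def)
    ultimately show ?thesis by (auto simp: p_def elim: Ints_cases)
  qed
  ultimately show ?thesis using that inj unfolding integer_system_def by blast
qed

definition avoidable :: "'n::finite set \<Rightarrow> (real ^ 'n) set \<Rightarrow> (real ^ 'n) set \<Rightarrow> bool" where
  "avoidable J U Z \<longleftrightarrow> closedin (top_of_set (coord_space J \<inter> U)) Z \<and>
     (\<forall>x\<in>coord_space J \<inter> U. rational_vec x \<longrightarrow>
        (\<exists>v\<in>coord_space J. rational_vec v \<and> (\<forall>\<epsilon>>0. \<exists>\<tau>. \<bar>\<tau>\<bar> < \<epsilon> \<and> x + \<tau> *\<^sub>R v \<notin> Z)))"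

lemma rational_vec_add_scaleR:
  "rational_vec x \<Longrightarrow> rational_vec v \<Longrightarrow> \<tau> \<in> \<rat> \<Longrightarrow> rational_vec (x + \<tau> *\<^sub>R v)"
  by (simp add: rational_vec_def)

lemma rational_vec_axis: "rational_vec (axis j 1)"
  by (simp add: rational_vec_def axis_def)

text \<open>Used to dodge countably many given points: a small multiple of an axis moves
  \<open>x\<close> off \<open>c\<close> if \<open>x = c\<close>, and otherwise
  \<open>\<tau> = 0\<close> will do.\<close>

lemma avoidable_singleton:
  fixes c :: "real ^ 'n"
  assumes "J \<noteq> {}" "c \<in> coord_space J \<inter> U"
  shows "avoidable J U {c}"
  unfolding avoidable_def
proof (intro conjI ballI impI)
  show "closedin (top_of_set (coord_space J \<inter> U)) {c}" using assms by (simp add: closedin_closed_eq closed_subset)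
  fix x :: "real ^ 'n"
  obtain j where j: "j \<in> J" using assms by blast
  have ne: "axis j 1 \<noteq> (0 :: real ^ 'n)" by simp
  have "\<exists>\<tau>. \<bar>\<tau>\<bar> < \<epsilon> \<and> x + \<tau> *\<^sub>R axis j 1 \<notin> {c}" if "\<epsilon> > 0" for \<epsilon> :: real
  proof (cases "x = c")
    case True
    then show ?thesis using that ne by (intro exI[of _ "\<epsilon>/2"]) (auto simp: axis_eq_0_iff)
  qed (use that in \<open>auto intro: exI[of _ 0]\<close>)
  then show "\<exists>v\<in>coord_space J. rational_vec v \<and> (\<forall>\<epsilon>>0. \<exists>\<tau>. \<bar>\<tau>\<bar> < \<epsilon> \<and> x + \<tau> *\<^sub>R v \<notin> {c})"
    using axis_in_coord_space[OF j] rational_vec_axis by blast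
qed

text \<open>The direction must be nonzero to span a line, and the parameter rational to reach a
  rational point. The complement of \<open>Z\<close> is open in the slice, so an admissible
  parameter can be replaced by a rational one next to it.\<close>

lemma avoidable_direction:
  fixes x :: "real ^ 'n"
  assumes Z: "avoidable J U Z" and "open U" and x: "x \<in> coord_space J \<inter> U" "rational_vec x" and "J \<noteq> {}"
  obtains v where "v \<in> coord_space J" "rational_vec v" "v \<noteq> 0"
    "\<And>\<epsilon>. \<epsilon> > 0 \<Longrightarrow> \<exists>\<tau>\<in>\<rat>. \<bar>\<tau>\<bar> < \<epsilon> \<and> x + \<tau> *\<^sub>R v \<notin> Z"
proof -
  obtain v0 where v0: "v0 \<in> coord_space J" "rational_vec v0" "\<And>\<epsilon>. \<epsilon> > 0 \<Longrightarrow> \<exists>\<tau>. \<bar>\<tau>\<bar> < \<epsilon> \<and> x + \<tau> *\<^sub>R v0 \<notin> Z"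
    using Z x unfolding avoidable_def by blast
  obtain j where j: "j \<in> J" using assms by blast
  have "\<exists>v\<in>coord_space J. rational_vec v \<and> v \<noteq> 0 \<and> (\<forall>\<epsilon>>0. \<exists>\<tau>. \<bar>\<tau>\<bar> < \<epsilon> \<and> x + \<tau> *\<^sub>R v \<notin> Z)"
  proof (cases "v0 = 0")
    \<comment> \<open>The direction 0 can only occur when \<open>x\<close> itself lies outside
      \<open>Z\<close>; then any axis works with parameter 0.\<close>
    case True
    then have "x \<notin> Z" using v0(3)[of 1] by auto
    then show ?thesis using axis_in_coord_space[OF j, of 1] rational_vec_axis[of j]
      by (intro bexI[of _ "axis j 1"]) (auto simp: axis_eq_0_iff intro: exI[of _ 0])
  qed (use v0 in blast)
  then obtain v where v: "v \<in> coord_space J" "rational_vec v" "v \<noteq> 0"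
    and nz: "\<And>\<epsilon>. \<epsilon> > 0 \<Longrightarrow> \<exists>\<tau>. \<bar>\<tau>\<bar> < \<epsilon> \<and> x + \<tau> *\<^sub>R v \<notin> Z" by blast
  obtain C where C: "closed C" "Z = coord_space J \<inter> U \<inter> C"
    using Z unfolding avoidable_def closedin_closed by blast
  have "\<exists>\<tau>\<in>\<rat>. \<bar>\<tau>\<bar> < \<epsilon> \<and> x + \<tau> *\<^sub>R v \<notin> Z" if \<epsilon>: "\<epsilon> > 0" for \<epsilon> :: real
  proof -
    have "open ((\<lambda>\<tau>. x + \<tau> *\<^sub>R v) -` U)" by (intro open_vimage \<open>open U\<close> continuous_intros)
    moreover have "0 \<in> (\<lambda>\<tau>. x + \<tau> *\<^sub>R v) -` U" using x by simp
    ultimately have "\<exists>e>0. \<forall>\<tau>. dist \<tau> 0 < e \<longrightarrow> \<tau> \<in> (\<lambda>\<tau>. x + \<tau> *\<^sub>R v) -` U"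
      unfolding open_dist by blast
    then obtain e where e: "e > 0" "\<And>\<tau>. \<bar>\<tau>\<bar> < e \<Longrightarrow> x + \<tau> *\<^sub>R v \<in> U" by auto
    obtain \<tau> where \<tau>: "\<bar>\<tau>\<bar> < min e \<epsilon>" "x + \<tau> *\<^sub>R v \<notin> Z" using nz[of "min e \<epsilon>"] e \<epsilon> by auto
    moreover have "x + \<tau> *\<^sub>R v \<in> coord_space J"
      using x v subspace_coord_space by (auto intro!: subspace_add subspace_scale)
    ultimately have \<tau>C: "x + \<tau> *\<^sub>R v \<notin> C" using C e by auto
    let ?W = "{-\<epsilon><..<\<epsilon>} \<inter> (\<lambda>\<tau>. x + \<tau> *\<^sub>R v) -` (- C)"
    have "open ?W" by (intro open_Int open_vimage continuous_intros) (use C in auto)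
    moreover have "\<tau> \<in> ?W" using \<tau> \<tau>C by auto
    ultimately obtain e' where e': "e' > 0" "ball \<tau> e' \<subseteq> ?W" using openE by blast
    obtain s where s: "s \<in> \<rat>" "\<tau> < s" "s < \<tau> + e'" using Rats_dense_in_real[of \<tau> "\<tau> + e'"] e' by auto
    then have "s \<in> ball \<tau> e'" by (auto simp: dist_real_def)
    then have "s \<in> ?W" using e' by blast
    then show ?thesis using s C by (intro bexI[of _ s]) auto
  qed
  then show ?thesis using that v by blast
qed

text \<open>The order of choices matters: the new line through \<open>x\<close>, with its equations,
  comes first and determines \<open>T'\<close> independently of the point on it. Only then is
  \<open>x'\<close> chosen on the line, so close to \<open>x\<close> that the old equations, exact
  at \<open>x\<close>, hold up to \<open>f T'\<close> on a whole ball around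
  \<open>x'\<close>.\<close>

lemma approximation_step:
  fixes x :: "real ^ 'n"
  assumes Z: "avoidable J U Z" and "open U" and x: "x \<in> coord_space J" "rational_vec x"
    and \<rho>: "\<rho> > 0" "cball x \<rho> \<subseteq> U" and g: "g < card J" and sys: "integer_system J g T q p x"
    and f: "\<And>t. t > 0 \<Longrightarrow> f t > (0 :: real)" and "T > 0"
  obtains x' q' p' T' \<rho>' where "x' \<in> coord_space J" "rational_vec x'" "\<rho>' > 0"
    "cball x' \<rho>' \<subseteq> cball x \<rho>" "T' \<ge> T + 1" "integer_system J g T' q' p' x'"
    "cball x' \<rho>' \<inter> coord_space J \<inter> Z = {}"
    "\<And>y i. y \<in> cball x' \<rho>' \<Longrightarrow> i \<in> {1..g} \<Longrightarrow> \<bar>q i \<bullet> y - of_int (p i)\<bar> \<le> f T'"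
proof -
  have "J \<noteq> {}" using g by auto
  have xU: "x \<in> coord_space J \<inter> U" using x \<rho> by (auto simp: subset_iff)
  obtain v where v: "v \<in> coord_space J" "rational_vec v" "v \<noteq> 0"
    and nz: "\<And>\<epsilon>. \<epsilon> > 0 \<Longrightarrow> \<exists>\<tau>\<in>\<rat>. \<bar>\<tau>\<bar> < \<epsilon> \<and> x + \<tau> *\<^sub>R v \<notin> Z"
    using avoidable_direction[OF Z \<open>open U\<close> xU x(2) \<open>J \<noteq> {}\<close>] by metis
  obtain q' p' T0 where sys': "\<And>\<tau>. integer_system J g T0 q' p' (x + \<tau> *\<^sub>R v)"
    using rational_line_integer_system[OF x(2) v(2,1,3) g] by metis
  \<comment> \<open>Growth by at least 1 per step drives the bounds to infinity.\<close>
  define T' where "T' = max T0 (T + 1)"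
  have fT': "f T' > 0" using f \<open>T > 0\<close> by (auto simp: T'_def)
  define W where "W = ball x \<rho> \<inter> (\<Inter>i\<in>{1..g}. {y. \<bar>q i \<bullet> y - of_int (p i)\<bar> < f T'})"
  have "open W" unfolding W_def
    by (intro open_Int open_INT ballI open_Collect_less continuous_intros) auto
  have "x \<in> W" using \<rho> sys fT' by (auto simp: W_def integer_system_def)
  have "open ((\<lambda>\<tau>. x + \<tau> *\<^sub>R v) -` W)" by (intro open_vimage \<open>open W\<close> continuous_intros)
  moreover have "0 \<in> (\<lambda>\<tau>. x + \<tau> *\<^sub>R v) -` W" using \<open>x \<in> W\<close> by simp
  ultimately have "\<exists>e>0. \<forall>\<tau>. dist \<tau> 0 < e \<longrightarrow> \<tau> \<in> (\<lambda>\<tau>. x + \<tau> *\<^sub>R v) -` W"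
    unfolding open_dist by blast
  then obtain e where e: "e > 0" "\<And>\<tau>. \<bar>\<tau>\<bar> < e \<Longrightarrow> x + \<tau> *\<^sub>R v \<in> W" by auto
  obtain \<tau> where \<tau>: "\<tau> \<in> \<rat>" "\<bar>\<tau>\<bar> < e" "x + \<tau> *\<^sub>R v \<notin> Z" using nz e by blast
  define x' where "x' = x + \<tau> *\<^sub>R v"
  have x': "x' \<in> coord_space J" unfolding x'_def
    using x v subspace_coord_space by (auto intro!: subspace_add subspace_scale)
  have "x' \<in> W" using e \<tau> by (simp add: x'_def)
  obtain C where C: "closed C" "Z = coord_space J \<inter> U \<inter> C"
    using Z unfolding avoidable_def closedin_closed by blast
  have "x' \<in> U" using \<open>x' \<in> W\<close> \<rho> by (auto simp: W_def subset_iff)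
  then have "x' \<in> W \<inter> - C" using \<open>x' \<in> W\<close> x' \<tau> C by (auto simp: x'_def)
  moreover have "open (W \<inter> - C)" using \<open>open W\<close> C by auto
  ultimately obtain \<rho>' where \<rho>': "\<rho>' > 0" "cball x' \<rho>' \<subseteq> W \<inter> - C" by (meson open_contains_cball)
  show ?thesis
  proof (rule that[of x' \<rho>' T' q' p'])
    show "rational_vec x'" unfolding x'_def by (rule rational_vec_add_scaleR) (use x v \<tau> in auto)
    show "cball x' \<rho>' \<subseteq> cball x \<rho>" using \<rho>' by (auto simp: W_def subset_iff less_imp_le)
    show "integer_system J g T' q' p' x'" using sys'[of \<tau>] by (auto simp: x'_def T'_def integer_system_def)
    show "cball x' \<rho>' \<inter> coord_space J \<inter> Z = {}" using \<rho>' C by auto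
    show "\<bar>q i \<bullet> y - of_int (p i)\<bar> \<le> f T'" if "y \<in> cball x' \<rho>'" "i \<in> {1..g}" for y i
    proof -
      have "y \<in> W" using that \<rho>' by blast
      then show ?thesis using that by (auto simp: W_def less_imp_le)
    qed
  qed (use x' \<rho>' in \<open>auto simp: T'_def\<close>)
qed

section \<open>Nested balls and their limit point\<close>

lemma rational_vec_dense_coord_space:
  fixes U :: "(real ^ 'n) set"
  assumes "open U" "coord_space J \<inter> U \<noteq> {}"
  obtains x where "x \<in> coord_space J \<inter> U" "rational_vec x"
proof -
  obtain z where z: "z \<in> coord_space J" "z \<in> U" using assms by blast
  obtain e where e: "e > 0" "ball z e \<subseteq> U" using assms z openE by blast
  define \<delta> where "\<delta> = e / (2 * real CARD('n))"
  have \<delta>: "\<delta> > 0" using e by (simp add: \<delta>_def)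
  have "\<forall>i. \<exists>s\<in>\<rat>. z $ i < s \<and> s < z $ i + \<delta>" using Rats_dense_in_real \<delta> by simp
  then obtain s where s: "\<And>i. s i \<in> \<rat>" "\<And>i. z $ i < s i \<and> s i < z $ i + \<delta>" by metis
  define x where "x = (\<chi> i. if i \<in> J then s i else 0)"
  have zx: "\<bar>(z - x) $ i\<bar> \<le> \<delta>" for i using z s(2)[of i] \<delta> by (auto simp: x_def coord_space_def)
  have "dist z x \<le> (\<Sum>i\<in>UNIV. \<bar>(z - x) $ i\<bar>)" unfolding dist_norm by (rule norm_le_l1_cart)
  also have "\<dots> \<le> (\<Sum>i\<in>(UNIV::'n set). \<delta>)" by (intro sum_mono zx)
  also have "\<dots> < e" using e by (simp add: \<delta>_def)
  finally have "x \<in> U" using e by auto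
  then show ?thesis using s(1) by (intro that[of x]) (auto simp: x_def coord_space_def rational_vec_def)
qed

text \<open>A point \<open>y\<close> common to all nested balls inherits every approximation. For
  \<open>T n \<le> t < T (Suc n)\<close> the \<open>n\<close>-th system has size at most
  \<open>t\<close> and error at most \<open>f (T (Suc n)) \<le> f t\<close>, as \<open>f\<close> is
  non-increasing.\<close>

lemma exists_uniformly_approximable_avoiding:
  fixes U :: "(real ^ 'n) set" and f :: "real \<Rightarrow> real"
  assumes "open U" "coord_space J \<inter> U \<noteq> {}" and g: "g < card J"
    and \<Z>: "countable \<Z>" "\<And>Z. Z \<in> \<Z> \<Longrightarrow> avoidable J U Z"
    and f: "\<And>t. t > 0 \<Longrightarrow> f t > 0" "antimono_on {0<..} f"
  obtains y where "y \<in> coord_space J \<inter> U" "y \<notin> \<Union>\<Z>"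
    "\<forall>\<^sub>F t in at_top. \<exists>q p. inj_on q {1..g} \<and> independent (q ` {1..g}) \<and>
      (\<forall>i\<in>{1..g}. integer_vec (q i) \<and> q i \<in> coord_space J \<and> infnorm (q i) \<le> t \<and> \<bar>q i \<bullet> y - of_int (p i)\<bar> \<le> f t)"
proof -
  have "J \<noteq> {}" using g by auto
  \<comment> \<open>The empty set is added so that the family can be enumerated even when
    \<open>\<Z>\<close> is empty.\<close>
  have Z0: "avoidable J U {}"
    using \<open>J \<noteq> {}\<close> by (auto simp: avoidable_def rational_vec_def coord_space_def intro!: bexI[of _ 0] intro: exI[of _ 0])
  define \<zeta> where "\<zeta> = from_nat_into (insert {} \<Z>)"
  have \<zeta>: "avoidable J U (\<zeta> n)" for n
    using from_nat_into[of "insert {} \<Z>" n] \<Z> Z0 by (auto simp: \<zeta>_def)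
  have range\<zeta>: "range \<zeta> = insert {} \<Z>" unfolding \<zeta>_def using \<Z> by (intro range_from_nat_into) auto
  define P where "P = (\<lambda>(n::nat) (x, q, p, T, \<rho>). x \<in> coord_space J \<and> rational_vec x \<and> \<rho> > 0 \<and> cball x \<rho> \<subseteq> U \<and>
     T \<ge> 1 \<and> integer_system J g T q p x)"
  \<comment> \<open>Step \<open>n\<close> removes \<open>\<zeta> n\<close>, and the error of the old
    system is measured against the new bound \<open>T'\<close>.\<close>
  define Q where "Q = (\<lambda>n (x, q, p, T, \<rho>) (x', q' :: nat \<Rightarrow> real ^ 'n, p' :: nat \<Rightarrow> int, T', \<rho>').
     cball x' \<rho>' \<subseteq> cball x \<rho> \<and> T' \<ge> T + 1 \<and> cball x' \<rho>' \<inter> coord_space J \<inter> \<zeta> n = {} \<and>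
     (\<forall>y\<in>cball x' \<rho>'. \<forall>i\<in>{1..g}. \<bar>q i \<bullet> y - of_int (p i)\<bar> \<le> f T'))"
  have "\<exists>F. \<forall>n. P n (F n) \<and> Q n (F n) (F (Suc n))"
  proof (rule dependent_nat_choice)
    obtain x where x: "x \<in> coord_space J \<inter> U" "rational_vec x"
      using rational_vec_dense_coord_space assms by metis
    obtain \<rho> where \<rho>: "\<rho> > 0" "cball x \<rho> \<subseteq> U" using x assms(1) by (meson IntD2 open_contains_cball)
    obtain j where j: "j \<in> J" using \<open>J \<noteq> {}\<close> by blast
    obtain q p T where "\<And>\<tau>. integer_system J g T q p (x + \<tau> *\<^sub>R axis j 1)"
      by (rule rational_line_integer_system[OF x(2) rational_vec_axis axis_in_coord_space[OF j] _ g]) (auto simp: axis_eq_0_iff)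
    from this[of 0] have "integer_system J g (max T 1) q p x" by (auto simp: integer_system_def)
    then show "\<exists>s. P 0 s" using x \<rho> by (intro exI[of _ "(x, q, p, max T 1, \<rho>)"]) (auto simp: P_def)
  next
    fix s n assume "P n s"
    obtain x q p T \<rho> where s: "s = (x, q, p, T, \<rho>)" by (metis prod.collapse)
    have *: "x \<in> coord_space J" "rational_vec x" "\<rho> > 0" "cball x \<rho> \<subseteq> U" "T > 0" "T \<ge> 1" "integer_system J g T q p x"
      using \<open>P n s\<close> by (auto simp: P_def s)
    obtain x' q' p' T' \<rho>' where st: "x' \<in> coord_space J" "rational_vec x'" "\<rho>' > 0"
      "cball x' \<rho>' \<subseteq> cball x \<rho>" "T' \<ge> T + 1" "integer_system J g T' q' p' x'"
      "cball x' \<rho>' \<inter> coord_space J \<inter> \<zeta> n = {}"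
      and st2: "\<And>y i. y \<in> cball x' \<rho>' \<Longrightarrow> i \<in> {1..g} \<Longrightarrow> \<bar>q i \<bullet> y - of_int (p i)\<bar> \<le> f T'"
      by (rule approximation_step[where f = f, OF \<zeta>[of n] \<open>open U\<close> *(1,2,3,4) g *(7) f(1) *(5)])
         ((assumption | rule that)+)
    then show "\<exists>s'. P (Suc n) s' \<and> Q n s s'"
      using * by (intro exI[of _ "(x', q', p', T', \<rho>')"]) (auto simp: P_def Q_def s)
  qed
  then obtain F where F: "\<And>n. P n (F n)" "\<And>n. Q n (F n) (F (Suc n))" by blast
  define x where "x n = fst (F n)" for n
  define q where "q n = fst (snd (F n))" for n
  define p where "p n = fst (snd (snd (F n)))" for n
  define T where "T n = fst (snd (snd (snd (F n))))" for n
  define \<rho> where "\<rho> n = snd (snd (snd (snd (F n))))" for n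
  have Fn: "F n = (x n, q n, p n, T n, \<rho> n)" for n by (simp add: x_def q_def p_def T_def \<rho>_def)
  have P: "x n \<in> coord_space J" "\<rho> n > 0" "cball (x n) (\<rho> n) \<subseteq> U" "T n \<ge> 1" "integer_system J g (T n) (q n) (p n) (x n)" for n
    using F(1)[of n] by (auto simp: P_def Fn)
  have Q: "cball (x (Suc n)) (\<rho> (Suc n)) \<subseteq> cball (x n) (\<rho> n)" "T (Suc n) \<ge> T n + 1"
      "cball (x (Suc n)) (\<rho> (Suc n)) \<inter> coord_space J \<inter> \<zeta> n = {}" for n
    using F(2)[of n] by (simp_all add: Q_def Fn)
  have Q': "\<bar>q n i \<bullet> y - of_int (p n i)\<bar> \<le> f (T (Suc n))"
    if "y \<in> cball (x (Suc n)) (\<rho> (Suc n))" "i \<in> {1..g}" for n y i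
    using F(2)[of n] that by (simp add: Q_def Fn)
  \<comment> \<open>Intersecting with the closed set \<open>coord_space J\<close> keeps the limit
    point in the slice.\<close>
  have "\<Inter> (range (\<lambda>n. cball (x n) (\<rho> n) \<inter> coord_space J)) \<noteq> {}"
  proof (rule compact_nest)
    fix n show "compact (cball (x n) (\<rho> n) \<inter> coord_space J)"
      by (intro compact_Int_closed compact_cball closed_subspace subspace_coord_space)
    show "cball (x n) (\<rho> n) \<inter> coord_space J \<noteq> {}" using P(1,2)[of n] by (metis IntI centre_in_cball empty_iff less_imp_le)
  next
    fix m n :: nat assume "m \<le> n"
    then show "cball (x n) (\<rho> n) \<inter> coord_space J \<subseteq> cball (x m) (\<rho> m) \<inter> coord_space J"
      using lift_Suc_antimono_le[of "\<lambda>n. cball (x n) (\<rho> n)"] Q(1) by blast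
  qed
  then obtain y where y: "\<And>n. y \<in> cball (x n) (\<rho> n)" "y \<in> coord_space J" by blast
  show ?thesis
  proof (rule that[of y])
    show "y \<in> coord_space J \<inter> U" using y P(3) by blast
    have "y \<notin> \<zeta> n" for n using y Q(3) by blast
    then show "y \<notin> \<Union>\<Z>" using range\<zeta> by blast
    have T_ge: "T n \<ge> real n" for n
    proof (induction n)
      case 0 show ?case using P(4)[of 0] by simp
    next
      case (Suc n) then show ?case using Q(2)[of n] by simp
    qed
    have "\<exists>q p. inj_on q {1..g} \<and> independent (q ` {1..g}) \<and>
      (\<forall>i\<in>{1..g}. integer_vec (q i) \<and> q i \<in> coord_space J \<and> infnorm (q i) \<le> t \<and> \<bar>q i \<bullet> y - of_int (p i)\<bar> \<le> f t)"
      if t: "T 0 \<le> t" for t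
    proof -
      obtain n0 where "t < real n0" using reals_Archimedean2 by blast
      then have ex: "t < T n0" using T_ge[of n0] by linarith
      \<comment> \<open>\<open>m\<close> is the first stage whose bound exceeds \<open>t\<close>; it
        is not 0 since \<open>T 0 \<le> t\<close>, so its predecessor \<open>n\<close> satisfies
        \<open>T n \<le> t\<close>.\<close>
      define m where "m = (LEAST m. t < T m)"
      have m: "t < T m" unfolding m_def using ex by (rule LeastI)
      then have "m \<noteq> 0" using t by (cases m) auto
      then obtain n where n: "m = Suc n" by (cases m) auto
      have "T n \<le> t" using not_less_Least[of n "\<lambda>m. t < T m"] n unfolding m_def by auto
      have "f (T (Suc n)) \<le> f t"
        using f(2) m n t P(4)[of 0] by (intro monotone_onD[OF f(2)]) auto
      then show ?thesis
        using P(5)[of n] Q'[OF y(1), of _ n] \<open>T n \<le> t\<close> unfolding integer_system_def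
        by (intro exI[of _ "q n"] exI[of _ "p n"]) force
    qed
    then show "\<forall>\<^sub>F t in at_top. \<exists>q p. inj_on q {1..g} \<and> independent (q ` {1..g}) \<and>
      (\<forall>i\<in>{1..g}. integer_vec (q i) \<and> q i \<in> coord_space J \<and> infnorm (q i) \<le> t \<and> \<bar>q i \<bullet> y - of_int (p i)\<bar> \<le> f t)"
      by (auto simp: eventually_at_top_linorder)
  qed
qed

section \<open>Charts of the submanifold\<close>

lemma dim_coord_space: "dim (coord_space (J :: 'n::finite set)) = card J"
  using dim_substandard_cart[of J, where 'a = real] by (simp add: coord_space_def dim_vec_eq)

definition coord_proj :: "'n::finite set \<Rightarrow> real ^ 'n \<Rightarrow> real ^ 'n" where
  "coord_proj J x = (\<chi> i. if i \<in> J then x $ i else 0)"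

lemma linear_coord_proj: "linear (coord_proj J)"
  by (rule linearI) (auto simp: coord_proj_def vec_eq_iff)

lemma coord_proj_in: "coord_proj J x \<in> coord_space J"
  by (simp add: coord_proj_def coord_space_def)

lemma coord_proj_eq_self: "x \<in> coord_space J \<Longrightarrow> coord_proj J x = x"
  by (auto simp: coord_proj_def coord_space_def vec_eq_iff)

lemma coord_space_subset_span:
  assumes "subspace M" "\<And>j. j \<in> J \<Longrightarrow> axis j 1 \<in> M"
  shows "coord_space J \<subseteq> M"
proof
  fix x assume x: "x \<in> coord_space J"
  have "x = (\<Sum>j\<in>J. x $ j *\<^sub>R axis j 1)"
    using x by (auto simp: vec_eq_iff coord_space_def axis_def sum.delta if_distrib cong: if_cong)
  also have "\<dots> \<in> M" using assms by (intro subspace_sum subspace_scale)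
  finally show "x \<in> M" .
qed

text \<open>A coordinate set of least cardinality that still separates the points of \<open>M\<close> works.\<close>
lemma coordinates_on_subspace:
  fixes M :: "(real ^ 'n) set"
  assumes M: "subspace M"
  obtains J where "card J = dim M" "\<And>w. w \<in> M \<Longrightarrow> coord_proj J w = 0 \<Longrightarrow> w = 0"
proof -
  define A where "A J \<longleftrightarrow> (\<forall>w\<in>M. coord_proj J w = 0 \<longrightarrow> w = 0)" for J :: "'n set"
  have "A UNIV" by (auto simp: A_def coord_proj_def vec_eq_iff)
  then obtain J where J: "A J" and min: "\<And>J'. A J' \<Longrightarrow> card J \<le> card J'"
    using ex_has_least_nat[of A UNIV card] by blast
  have inj: "inj_on (coord_proj J) M"
    using J linear_diff[OF linear_coord_proj] subspace_diff[OF M]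
    unfolding A_def inj_on_def by (metis eq_iff_diff_eq_0)
  let ?M = "coord_proj J ` M"
  have dimM: "dim ?M = dim M"
    using inj M by (intro dim_image_eq linear_coord_proj) (simp add: span_eq_iff[THEN iffD2])
  have sub: "?M \<subseteq> coord_space J" using coord_proj_in by blast
  have subM: "subspace ?M" using linear_coord_proj M by (rule linear_subspace_image)
  have "coord_space J \<subseteq> ?M"
  proof (rule coord_space_subset_span[OF subM])
    fix j assume j: "j \<in> J"
    \<comment> \<open>Minimality: without \<open>j\<close> some nonzero \<open>w\<close> in
      \<open>M\<close> projects to 0, so its projection to \<open>J\<close> is a multiple of
      \<open>axis j 1\<close>, nonzero because \<open>J\<close> still separates.\<close>
    have "\<not> A (J - {j})" using min[of "J - {j}"] j card_Diff1_less[of J j] by auto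
    then obtain w where w: "w \<in> M" "coord_proj (J - {j}) w = 0" "w \<noteq> 0" by (auto simp: A_def)
    have "w $ i = 0" if "i \<in> J - {j}" for i
      using w(2) that by (auto simp: coord_proj_def vec_eq_iff split: if_splits)
    then have e: "coord_proj J w = w $ j *\<^sub>R axis j 1"
      using j by (auto simp: coord_proj_def vec_eq_iff axis_def)
    then have "w $ j \<noteq> 0" using J w by (auto simp: A_def)
    then have "axis j 1 = coord_proj J ((1 / w $ j) *\<^sub>R w)"
      by (simp add: linear_scale[OF linear_coord_proj] e)
    then show "axis j 1 \<in> ?M" using w(1) M by (auto intro: subspace_scale)
  qed
  then have "?M = coord_space J" using sub by blast
  then have "card J = dim M" using dimM dim_coord_space[of J] by simp
  then show ?thesis using that J by (auto simp: A_def)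
qed

section \<open>Slice charts and hyperplanes\<close>

definition slice_chart ::
    "nat \<Rightarrow> (real ^ 'n) set \<Rightarrow> (real ^ 'n) set \<Rightarrow> (real ^ 'n) set \<Rightarrow> (real ^ 'n \<Rightarrow> real ^ 'n) \<Rightarrow>
      (real ^ 'n \<Rightarrow> real ^ 'n) \<Rightarrow> (real ^ 'n) set \<Rightarrow> bool" where
  "slice_chart d Y U V \<phi> \<psi> L \<longleftrightarrow> open U \<and> open V \<and> homeomorphism U V \<phi> \<psi> \<and>
        real_analytic_on U \<phi> \<and> real_analytic_on V \<psi> \<and>
        subspace L \<and> dim L = d \<and> \<phi> ` (Y \<inter> U) = V \<inter> L"

lemma analytic_submanifold_chart:
  assumes "analytic_submanifold d Y" "y \<in> Y"
  obtains U V \<phi> \<psi> L where "slice_chart d Y U V \<phi> \<psi> L" "y \<in> U"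
  using assms unfolding analytic_submanifold_def slice_chart_def by metis

lemma slice_chart_homeo:
  assumes "slice_chart d Y U V \<phi> \<psi> L"
  shows "\<And>y. y \<in> U \<Longrightarrow> \<phi> y \<in> V" "\<And>y. y \<in> U \<Longrightarrow> \<psi> (\<phi> y) = y"
    "\<And>u. u \<in> V \<Longrightarrow> \<psi> u \<in> U" "\<And>u. u \<in> V \<Longrightarrow> \<phi> (\<psi> u) = u"
    "continuous_on U \<phi>" "continuous_on V \<psi>"
  using assms unfolding slice_chart_def homeomorphism_def by auto

lemma slice_chart_mem:
  assumes "slice_chart d Y U V \<phi> \<psi> L"
  shows "\<And>y. y \<in> Y \<Longrightarrow> y \<in> U \<Longrightarrow> \<phi> y \<in> L" "\<And>u. u \<in> V \<Longrightarrow> u \<in> L \<Longrightarrow> \<psi> u \<in> Y"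
proof -
  have e: "\<phi> ` (Y \<inter> U) = V \<inter> L" using assms by (simp add: slice_chart_def)
  then show "\<And>y. y \<in> Y \<Longrightarrow> y \<in> U \<Longrightarrow> \<phi> y \<in> L" by blast
  fix u assume "u \<in> V" "u \<in> L"
  then obtain y where "y \<in> Y \<inter> U" "u = \<phi> y" using e by blast
  then show "\<psi> u \<in> Y" using slice_chart_homeo(2)[OF assms] by auto
qed

lemma slice_chart_open_image:
  assumes "slice_chart d Y U V \<phi> \<psi> L" "open N" "N \<subseteq> V"
  shows "open (\<psi> ` N)"
proof -
  have "\<psi> ` N = U \<inter> \<phi> -` N"
    using slice_chart_homeo[OF assms(1)] assms(3) by (force simp: image_iff)
  moreover have "open (U \<inter> \<phi> -` N)"
    using assms slice_chart_homeo(5)[OF assms(1)] unfolding slice_chart_def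
    by (intro continuous_open_preimage) auto
  ultimately show ?thesis by simp
qed

text \<open>The inner product with \<open>a\<close> commutes with the sum; subtracting
  \<open>b\<close> only changes the coefficient of the zero multi-index.\<close>

lemma slice_chart_power_series:
  assumes "slice_chart d Y U V \<phi> \<psi> L" "u \<in> V"
  obtains r c where "power_series_at (\<lambda>u. a \<bullet> \<psi> u - b) u r c"
proof -
  obtain r c where rc: "power_series_at \<psi> u r c"
    using assms unfolding slice_chart_def real_analytic_on_iff_power_series by blast
  have "((\<lambda>\<alpha>. mpow h \<alpha> *\<^sub>R (a \<bullet> c \<alpha> + (if \<alpha> = (\<lambda>_. 0) then - b else 0))) has_sum (a \<bullet> \<psi> (u + h) - b)) UNIV"
    if h: "\<forall>i. \<bar>h $ i\<bar> < r" for h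
  proof -
    have "((\<lambda>\<alpha>. mpow h \<alpha> *\<^sub>R c \<alpha>) has_sum \<psi> (u + h)) UNIV"
      using rc h by (auto simp: power_series_at_def)
    then have 1: "((\<lambda>\<alpha>. mpow h \<alpha> * (a \<bullet> c \<alpha>)) has_sum (a \<bullet> \<psi> (u + h))) UNIV"
      using has_sum_bounded_linear[OF bounded_linear_inner_right] by fastforce
    have "((\<lambda>\<alpha>. mpow h \<alpha> * (if \<alpha> = (\<lambda>_. 0) then - b else 0)) has_sum (- b)) UNIV"
      by (rule has_sum_finite_neutralI[of "{\<lambda>_. 0}"]) (auto simp: mpow_def)
    from has_sum_add[OF 1 this] show ?thesis by (simp add: distrib_left)
  qed
  then have "power_series_at (\<lambda>u. a \<bullet> \<psi> u - b) u r (\<lambda>\<alpha>. a \<bullet> c \<alpha> + (if \<alpha> = (\<lambda>_. 0) then - b else 0))"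
    using rc by (simp add: power_series_at_def)
  then show ?thesis by (rule that)
qed

lemma open_box_around: "open {z :: real ^ 'n. \<forall>i. \<bar>z $ i - u $ i\<bar> < r}"
  unfolding Collect_all_eq by (intro open_INT ballI open_Collect_less continuous_intros) auto

text \<open>Directions in \<open>L\<close> suffice, since \<open>Y\<close> near
  \<open>\<psi> u\<close> is the image of points of \<open>L\<close>: there the series of
  \<open>a \<bullet> \<psi> u - b\<close> is a sum of zeros, whatever it does off
  \<open>L\<close>.\<close>

lemma slice_chart_flat:
  assumes ch: "slice_chart d Y U V \<phi> \<psi> L" and u: "u \<in> V" "u \<in> L"
    and ps: "power_series_at (\<lambda>u. a \<bullet> \<psi> u - b) u r c" and flat: "\<And>m w. w \<in> L \<Longrightarrow> hpart c m w = 0"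
  obtains W where "open W" "\<psi> u \<in> W" "\<And>y. y \<in> Y \<inter> W \<Longrightarrow> a \<bullet> y = b"
proof -
  have "r > 0" using ps by (simp add: power_series_at_def)
  let ?N = "{z. \<forall>i. \<bar>z $ i - u $ i\<bar> < r} \<inter> V"
  have V: "open V" "subspace L" using ch by (auto simp: slice_chart_def)
  have "open ?N" using V open_box_around by blast
  then have "open (\<psi> ` ?N)" by (rule slice_chart_open_image[OF ch]) auto
  moreover have "\<psi> u \<in> \<psi> ` ?N" using u \<open>r > 0\<close> by auto
  moreover have "a \<bullet> y = b" if y: "y \<in> Y \<inter> \<psi> ` ?N" for y
  proof -
    obtain z where z: "z \<in> ?N" "y = \<psi> z" using y by blast
    then have "z \<in> L" using y slice_chart_mem(1)[OF ch, of y] slice_chart_homeo[OF ch] by auto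
    then have "z - u \<in> L" using u V by (auto intro: subspace_diff)
    then have "a \<bullet> \<psi> (u + (z - u)) - b = 0"
      using z flat by (intro power_series_at_eq_0[OF ps]) auto
    then show ?thesis using z by simp
  qed
  ultimately show ?thesis using that by blast
qed

text \<open>The points near which \<open>Y\<close> lies in the hyperplane form an open and closed subset of \<open>Y\<close>.\<close>
lemma connected_submanifold_hyperplane:
  assumes "connected Y" and sm: "analytic_submanifold d Y" and "open W" "y0 \<in> Y" "y0 \<in> W"
    and W: "\<And>y. y \<in> Y \<inter> W \<Longrightarrow> a \<bullet> y = b"
  shows "\<forall>y\<in>Y. a \<bullet> y = b"
proof -
  define A where "A = {y\<in>Y. \<exists>W. open W \<and> y \<in> W \<and> (\<forall>y'\<in>Y \<inter> W. a \<bullet> y' = b)}"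
  have "A = Y \<inter> \<Union>{W. open W \<and> (\<forall>y'\<in>Y \<inter> W. a \<bullet> y' = b)}" by (auto simp: A_def)
  then have "openin (top_of_set Y) A" by (metis (no_types, lifting) mem_Collect_eq open_Union openin_open_Int)
  moreover have "closedin (top_of_set Y) A"
    unfolding closedin_limpt
  proof (intro conjI allI impI)
    show "A \<subseteq> Y" by (auto simp: A_def)
    fix y assume y: "y islimpt A \<and> y \<in> Y"
    then obtain U V \<phi> \<psi> L where ch: "slice_chart d Y U V \<phi> \<psi> L" "y \<in> U"
      using analytic_submanifold_chart[OF sm] by metis
    note hom = slice_chart_homeo[OF ch(1)]
    have V: "open V" "subspace L" using ch by (auto simp: slice_chart_def)
    define u where "u = \<phi> y"
    have u: "u \<in> V" "u \<in> L" "\<psi> u = y" using hom slice_chart_mem[OF ch(1)] ch y by (auto simp: u_def)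
    obtain r c where ps: "power_series_at (\<lambda>u. a \<bullet> \<psi> u - b) u r c"
      using slice_chart_power_series[OF ch(1) u(1)] by metis
    have "r > 0" using ps by (simp add: power_series_at_def)
    let ?N = "{z. \<forall>i. \<bar>z $ i - u $ i\<bar> < r} \<inter> V"
    have "open ?N" using V open_box_around by blast
    then have "open (\<psi> ` ?N)" by (rule slice_chart_open_image[OF ch(1)]) auto
    moreover have "y \<in> \<psi> ` ?N" using u \<open>r > 0\<close> by force
    \<comment> \<open>The expansion is centred at the limit point \<open>y\<close>, and its
      convergence box contains the chart image of some point of \<open>A\<close>. Vanishing near
      that point along \<open>L\<close> makes all homogeneous parts at \<open>y\<close> vanish on
      \<open>L\<close>.\<close>
    ultimately have "\<exists>y1\<in>A. y1 \<in> \<psi> ` ?N \<and> y1 \<noteq> y" using conjunct1[OF y] by (simp only: islimpt_def)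
    then obtain y1 where y1: "y1 \<in> A" "y1 \<in> \<psi> ` ?N" by blast
    then obtain z where z: "z \<in> ?N" "y1 = \<psi> z" by blast
    obtain W1 where W1: "open W1" "y1 \<in> W1" "\<And>y'. y' \<in> Y \<inter> W1 \<Longrightarrow> a \<bullet> y' = b" and "y1 \<in> Y"
      using y1 by (auto simp: A_def)
    have "z \<in> L" using z \<open>y1 \<in> Y\<close> slice_chart_mem(1)[OF ch(1), of y1] hom by auto
    have "open (V \<inter> \<psi> -` W1)" using V W1 hom(6) by (intro continuous_open_preimage) auto
    then have N': "open ((+) u -` (V \<inter> \<psi> -` W1))" by (intro open_vimage continuous_intros)
    have "hpart c m w = 0" if "w \<in> L" for m w
    proof (rule hpart_eq_0_if_eq_0_near[OF ps V(2) _ _ N' _ _ that])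
      show "z - u \<in> L" using \<open>z \<in> L\<close> u V by (auto intro: subspace_diff)
      show "\<bar>(z - u) $ i\<bar> < r" for i using z by auto
      show "z - u \<in> (+) u -` (V \<inter> \<psi> -` W1)" using z W1 by auto
      fix z' assume "z' \<in> L" "z' \<in> (+) u -` (V \<inter> \<psi> -` W1)"
      then have "u + z' \<in> L" "u + z' \<in> V" "\<psi> (u + z') \<in> W1" using u V by (auto intro: subspace_add)
      then show "a \<bullet> \<psi> (u + z') - b = 0"
        using W1(3) slice_chart_mem(2)[OF ch(1)] by auto
    qed
    then obtain W' where "open W'" "\<psi> u \<in> W'" "\<And>y. y \<in> Y \<inter> W' \<Longrightarrow> a \<bullet> y = b"
      using slice_chart_flat[OF ch(1) u(1,2) ps] by metis
    then show "y \<in> A" using y u by (auto simp: A_def)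
  qed
  moreover have "y0 \<in> A" using assms by (auto simp: A_def)
  ultimately have "A = Y" using \<open>connected Y\<close> unfolding connected_clopen by blast
  then show ?thesis by (auto simp: A_def)
qed

section \<open>Level sets in graph coordinates\<close>

lemma has_derivative_imp_tendsto_direction:
  fixes F :: "'a::real_normed_vector \<Rightarrow> 'b::real_normed_vector"
  assumes F: "(F has_derivative F') (at x)"
  shows "((\<lambda>t. (F (x + t *\<^sub>R v) - F x) /\<^sub>R t) \<longlongrightarrow> F' v) (at 0)"
proof -
  have "((F \<circ> (\<lambda>t. x + t *\<^sub>R v)) has_derivative (F' \<circ> (\<lambda>t. t *\<^sub>R v))) (at 0)"
    by (rule diff_chain_at) (use F in \<open>auto intro!: derivative_eq_intros\<close>)
  then have "((\<lambda>h. norm (F (x + h *\<^sub>R v) - F x - F' (h *\<^sub>R v)) / norm h) \<longlongrightarrow> 0) (at 0)"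
    unfolding has_derivative_at by (simp add: o_def)
  moreover have "norm (F (x + h *\<^sub>R v) - F x - F' (h *\<^sub>R v)) / norm h = norm ((F (x + h *\<^sub>R v) - F x) /\<^sub>R h - F' v)"
    if "h \<noteq> 0" for h
  proof -
    have "F' (h *\<^sub>R v) = h *\<^sub>R F' v" using has_derivative_linear[OF F] by (rule linear_scale)
    then have "(F (x + h *\<^sub>R v) - F x) /\<^sub>R h - F' v = (F (x + h *\<^sub>R v) - F x - F' (h *\<^sub>R v)) /\<^sub>R h"
      using that by (simp add: scaleR_diff_right)
    then show ?thesis by (simp add: divide_inverse mult.commute)
  qed
  ultimately have "((\<lambda>h. norm ((F (x + h *\<^sub>R v) - F x) /\<^sub>R h - F' v)) \<longlongrightarrow> 0) (at 0)"
    by (elim Lim_transform_eventually) (auto simp: eventually_at_filter)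
  then show ?thesis using LIM_zero_cancel tendsto_norm_zero_iff by blast
qed

text \<open>The lowest homogeneous part that is not zero on all of \<open>L\<close>, composed with
  \<open>\<Theta>' x\<close>, is nonzero on an open set of directions that meets
  \<open>coord_space J\<close> by surjectivity, hence contains a rational direction there. If
  \<open>h \<circ> \<Theta>\<close> vanished on a short segment in that direction, this leading form
  would vanish at it.\<close>

lemma avoidable_level_set:
  fixes \<Theta> :: "real ^ 'n \<Rightarrow> real ^ 'n" and h :: "real ^ 'n \<Rightarrow> real"
  assumes "open U" and cont: "continuous_on (coord_space J \<inter> U) (h \<circ> \<Theta>)"
    and L: "\<And>x. x \<in> coord_space J \<inter> U \<Longrightarrow> \<Theta> x \<in> L" "subspace L"
    and der: "\<And>x. x \<in> coord_space J \<inter> U \<Longrightarrow> (\<Theta> has_derivative \<Theta>' x) (at x)"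
    and surj: "\<And>x w. x \<in> coord_space J \<inter> U \<Longrightarrow> w \<in> L \<Longrightarrow> \<exists>v\<in>coord_space J. \<Theta>' x v = w"
    and ps: "\<And>x. x \<in> coord_space J \<inter> U \<Longrightarrow>
      \<exists>r c. power_series_at h (\<Theta> x) r c \<and> (\<exists>m. \<exists>w\<in>L. hpart c m w \<noteq> 0)"
  shows "avoidable J U {x \<in> coord_space J \<inter> U. h (\<Theta> x) = 0}"
  unfolding avoidable_def
proof (intro conjI ballI impI)
  let ?Z = "{x \<in> coord_space J \<inter> U. h (\<Theta> x) = 0}"
  show "closedin (top_of_set (coord_space J \<inter> U)) ?Z"
    using continuous_closedin_preimage_constant[OF cont, of 0] by (simp add: o_def)
  fix x assume x: "x \<in> coord_space J \<inter> U" "rational_vec x"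
  obtain r c where rc: "power_series_at h (\<Theta> x) r c" and ex: "\<exists>m. \<exists>w\<in>L. hpart c m w \<noteq> 0"
    using ps[OF x(1)] by blast
  define m where "m = (LEAST m. \<exists>w\<in>L. hpart c m w \<noteq> 0)"
  obtain w where w: "w \<in> L" "hpart c m w \<noteq> 0" using LeastI_ex[OF ex] unfolding m_def by blast
  have lower: "hpart c k w = 0" if "k < m" "w \<in> L" for k w
    using not_less_Least[of k "\<lambda>m. \<exists>w\<in>L. hpart c m w \<noteq> 0"] that unfolding m_def by blast
  obtain v0 where v0: "v0 \<in> coord_space J" "\<Theta>' x v0 = w" using surj[OF x(1) w(1)] by blast
  have "continuous_on UNIV (\<lambda>v. hpart c m (\<Theta>' x v))"
    using has_derivative_linear[OF der[OF x(1)]]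
    by (intro continuous_on_compose2[OF continuous_on_hpart[of UNIV]] linear_continuous_on)
       (auto simp: linear_conv_bounded_linear)
  then have "open {v. hpart c m (\<Theta>' x v) \<noteq> 0}"
    by (intro open_Collect_neq continuous_intros)
  moreover have "coord_space J \<inter> {v. hpart c m (\<Theta>' x v) \<noteq> 0} \<noteq> {}" using v0 w by auto
  ultimately obtain v where v: "v \<in> coord_space J" "hpart c m (\<Theta>' x v) \<noteq> 0" "rational_vec v"
    using rational_vec_dense_coord_space by blast
  have "\<exists>\<tau>. \<bar>\<tau>\<bar> < \<epsilon> \<and> x + \<tau> *\<^sub>R v \<notin> ?Z" if "\<epsilon> > 0" for \<epsilon> :: real
  proof (rule ccontr)
    assume "\<not> (\<exists>\<tau>. \<bar>\<tau>\<bar> < \<epsilon> \<and> x + \<tau> *\<^sub>R v \<notin> ?Z)"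
    then have Z: "x + \<tau> *\<^sub>R v \<in> ?Z" if "\<bar>\<tau>\<bar> < \<epsilon>" for \<tau> using that by blast
    have "hpart c m (\<Theta>' x v) = 0"
    proof (rule leading_form_eq_0[OF rc lower])
      show "\<forall>\<^sub>F \<tau> in at 0. \<Theta> (x + \<tau> *\<^sub>R v) - \<Theta> x \<in> L \<and> h (\<Theta> (x + \<tau> *\<^sub>R v)) = 0"
        unfolding eventually_at
      proof (intro exI[of _ \<epsilon>] conjI ballI impI \<open>\<epsilon> > 0\<close>)
        fix \<tau> :: real assume "\<tau> \<noteq> 0 \<and> dist \<tau> 0 < \<epsilon>"
        then have "x + \<tau> *\<^sub>R v \<in> ?Z" by (intro Z) auto
        then show "\<Theta> (x + \<tau> *\<^sub>R v) - \<Theta> x \<in> L" "h (\<Theta> (x + \<tau> *\<^sub>R v)) = 0"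
          using L x by (auto intro: subspace_diff)
      qed
      show "((\<lambda>\<tau>. (\<Theta> (x + \<tau> *\<^sub>R v) - \<Theta> x) /\<^sub>R \<tau>) \<longlongrightarrow> \<Theta>' x v) (at 0)"
        by (rule has_derivative_imp_tendsto_direction[OF der[OF x(1)]])
    qed
    then show False using v by blast
  qed
  then show "\<exists>v\<in>coord_space J. rational_vec v \<and> (\<forall>\<epsilon>>0. \<exists>\<tau>. \<bar>\<tau>\<bar> < \<epsilon> \<and> x + \<tau> *\<^sub>R v \<notin> ?Z)"
    using v by blast
qed

text \<open>Differentiating \<open>\<phi> (\<psi> u) = u\<close> exhibits a left inverse of the
  derivative of \<open>\<psi>\<close>.\<close>

lemma slice_chart_derivative:
  assumes ch: "slice_chart d Y U V \<phi> \<psi> L"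
  obtains \<psi>' where "\<And>u. u \<in> V \<Longrightarrow> (\<psi> has_derivative blinfun_apply (\<psi>' u)) (at u)"
    "continuous_on V \<psi>'" "\<And>u. u \<in> V \<Longrightarrow> inj (blinfun_apply (\<psi>' u))"
proof -
  note hom = slice_chart_homeo[OF ch]
  have V: "open V" and ra: "real_analytic_on U \<phi>" "real_analytic_on V \<psi>" using ch by (auto simp: slice_chart_def)
  obtain \<psi>' where \<psi>': "\<And>u. u \<in> V \<Longrightarrow> (\<psi> has_derivative blinfun_apply (\<psi>' u)) (at u)" "continuous_on V \<psi>'"
    using real_analytic_on_C1[OF ra(2)] by blast
  obtain \<phi>' where \<phi>': "\<And>y. y \<in> U \<Longrightarrow> (\<phi> has_derivative blinfun_apply (\<phi>' y)) (at y)"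
    using real_analytic_on_C1[OF ra(1)] by blast
  have "inj (blinfun_apply (\<psi>' u))" if u: "u \<in> V" for u
  proof -
    have "((\<phi> \<circ> \<psi>) has_derivative (blinfun_apply (\<phi>' (\<psi> u)) \<circ> blinfun_apply (\<psi>' u))) (at u)"
      using u hom by (intro diff_chain_at \<psi>' \<phi>') auto
    moreover have "((\<phi> \<circ> \<psi>) has_derivative (\<lambda>h. h)) (at u)"
      by (rule has_derivative_transform_within_open[OF has_derivative_ident V u]) (use hom in auto)
    ultimately have "blinfun_apply (\<phi>' (\<psi> u)) \<circ> blinfun_apply (\<psi>' u) = (\<lambda>h. h)"
      by (rule has_derivative_unique)
    then show ?thesis by (metis comp_apply injI)
  qed
  then show ?thesis using \<psi>' that by blast
qed

text \<open>The \<open>J\<close>-coordinates of the chart parametrisation have an invertible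
  derivative at the base point, because \<open>J\<close> separates the points of the tangent space.
  \<open>G\<close> is the parametrisation composed with their local inverse, so \<open>G x\<close>
  and \<open>x\<close> agree on \<open>J\<close>.\<close>

lemma coordinate_chart:
  fixes Y W :: "(real ^ 'n) set"
  assumes sm: "analytic_submanifold d Y" and y0: "y0 \<in> Y" "y0 \<in> W" and "open W"
    and nonflat: "\<And>a b y W. rational_vec a \<Longrightarrow> a \<noteq> 0 \<Longrightarrow> b \<in> \<rat> \<Longrightarrow> y \<in> Y \<Longrightarrow> open W \<Longrightarrow> y \<in> W \<Longrightarrow>
      \<exists>y'\<in>Y \<inter> W. a \<bullet> y' \<noteq> b"
  obtains J O' G where "card J = d" "open O'" "coord_space J \<inter> O' \<noteq> {}"
    "\<And>x. x \<in> coord_space J \<inter> O' \<Longrightarrow> G x \<in> Y \<inter> W \<and> (\<forall>j\<in>J. G x $ j = x $ j)"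
    "\<And>a b. rational_vec a \<Longrightarrow> a \<noteq> 0 \<Longrightarrow> b \<in> \<rat> \<Longrightarrow> avoidable J O' {x \<in> coord_space J \<inter> O'. a \<bullet> G x = b}"
proof -
  obtain U V \<phi> \<psi> L where ch: "slice_chart d Y U V \<phi> \<psi> L" "y0 \<in> U"
    using analytic_submanifold_chart[OF sm y0(1)] by metis
  note hom = slice_chart_homeo[OF ch(1)]
  have V: "open V" "subspace L" "dim L = d" using ch by (auto simp: slice_chart_def)
  obtain \<psi>' where \<psi>': "\<And>u. u \<in> V \<Longrightarrow> (\<psi> has_derivative blinfun_apply (\<psi>' u)) (at u)"
    "continuous_on V \<psi>'" "\<And>u. u \<in> V \<Longrightarrow> inj (blinfun_apply (\<psi>' u))"
    using slice_chart_derivative[OF ch(1)] by metis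
  define u0 where "u0 = \<phi> y0"
  have u0: "u0 \<in> V" "u0 \<in> L" "\<psi> u0 = y0" using hom slice_chart_mem[OF ch(1)] ch y0 by (auto simp: u0_def)
  \<comment> \<open>Shrinking to the preimage of \<open>W\<close> forces the values of
    \<open>G\<close> into \<open>W\<close>.\<close>
  define V0 where "V0 = V \<inter> \<psi> -` W"
  have V0: "open V0" "u0 \<in> V0" "V0 \<subseteq> V"
    using V hom(6) \<open>open W\<close> u0 y0 by (auto simp: V0_def intro: continuous_open_preimage)
  \<comment> \<open>\<open>?M\<close> is the tangent space of \<open>Y\<close> at
    \<open>y0\<close>.\<close>
  let ?M = "blinfun_apply (\<psi>' u0) ` L"
  have lin\<psi>: "linear (blinfun_apply (\<psi>' u0))" by (rule bounded_linear.linear[OF blinfun.bounded_linear_right])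
  have M: "subspace ?M" using lin\<psi> V(2) by (rule linear_subspace_image)
  have dimM: "dim ?M = d"
    using dim_image_eq[OF lin\<psi>, of L] \<psi>'(3)[OF u0(1)] V by (metis inj_on_subset subset_UNIV)
  obtain J where J: "card J = d" "\<And>w. w \<in> ?M \<Longrightarrow> coord_proj J w = 0 \<Longrightarrow> w = 0"
    using coordinates_on_subspace[OF M] dimM by metis
  \<comment> \<open>\<open>\<Lambda>\<close> identifies the coordinate slice with \<open>L\<close>,
    both of dimension \<open>d\<close>, so that parameters and \<open>J\<close>-coordinates live in
    the same space.\<close>
  obtain \<Lambda> where \<Lambda>: "linear \<Lambda>" "\<Lambda> ` coord_space J = L" "inj_on \<Lambda> (coord_space J)"
    using subspace_isomorphism[OF subspace_coord_space V(2)] V(3) J(1) dim_coord_space[of J] by metis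
  have \<Lambda>L: "\<Lambda> x \<in> L" if "x \<in> coord_space J" for x using \<Lambda>(2) that by blast
  let ?P = "coord_proj J"
  define BP where "BP = Blinfun ?P"
  define B\<Lambda> where "B\<Lambda> = Blinfun \<Lambda>"
  have BP: "blinfun_apply BP = ?P" and B\<Lambda>: "blinfun_apply B\<Lambda> = \<Lambda>"
    unfolding BP_def B\<Lambda>_def using linear_coord_proj[of J] \<Lambda>(1)
    by (simp_all add: bounded_linear_Blinfun_apply linear_conv_bounded_linear)
  define \<kappa> where "\<kappa> = (\<lambda>x. \<Lambda> (?P x))"
  have \<kappa>: "\<kappa> = blinfun_apply (B\<Lambda> o\<^sub>L BP)" by (auto simp: \<kappa>_def BP B\<Lambda>)
  have \<kappa>bl: "bounded_linear \<kappa>" unfolding \<kappa> by (rule blinfun.bounded_linear_right)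
  define D where "D = \<kappa> -` V0"
  have "open D" unfolding D_def by (intro open_vimage V0 linear_continuous_on \<kappa>bl)
  \<comment> \<open>Near \<open>x0\<close>, \<open>\<Psi>\<close> is a local diffeomorphism of the whole space that maps \<open>coord_space J\<close> to itself; its
    inverse there parametrises \<open>Y\<close> by the coordinates in \<open>J\<close>.\<close>
  define \<Psi> where "\<Psi> x = ?P (\<psi> (\<kappa> x)) + (x - ?P x)" for x
  define \<Psi>' where "\<Psi>' x = (BP o\<^sub>L \<psi>' (\<kappa> x) o\<^sub>L (B\<Lambda> o\<^sub>L BP)) + (id_blinfun - BP)" for x
  have \<Psi>'_apply: "blinfun_apply (\<Psi>' x) v = ?P (\<psi>' (\<kappa> x) (\<kappa> v)) + (v - ?P v)" for x v
    by (simp add: \<Psi>'_def blinfun.add_left blinfun.diff_left BP B\<Lambda> \<kappa>_def)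
  have der\<Psi>: "(\<Psi> has_derivative blinfun_apply (\<Psi>' x)) (at x)" if x: "x \<in> D" for x
  proof -
    have "\<kappa> x \<in> V" using x V0 by (auto simp: D_def)
    then have "((\<psi> \<circ> \<kappa>) has_derivative (blinfun_apply (\<psi>' (\<kappa> x)) \<circ> \<kappa>)) (at x)"
      by (intro diff_chain_at \<psi>' bounded_linear_imp_has_derivative \<kappa>bl)
    then have "((\<lambda>x. blinfun_apply BP ((\<psi> \<circ> \<kappa>) x) + (x - blinfun_apply BP x)) has_derivative
       (\<lambda>v. blinfun_apply BP ((blinfun_apply (\<psi>' (\<kappa> x)) \<circ> \<kappa>) v) + (v - blinfun_apply BP v))) (at x)"
      by (intro has_derivative_add has_derivative_diff has_derivative_ident
            bounded_linear.has_derivative[OF blinfun.bounded_linear_right])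
    moreover have "blinfun_apply (\<Psi>' x) = (\<lambda>v. blinfun_apply BP ((blinfun_apply (\<psi>' (\<kappa> x)) \<circ> \<kappa>) v) + (v - blinfun_apply BP v))"
      by (rule ext) (simp add: \<Psi>'_apply BP)
    moreover have "\<Psi> = (\<lambda>x. blinfun_apply BP ((\<psi> \<circ> \<kappa>) x) + (x - blinfun_apply BP x))"
      by (rule ext) (simp add: \<Psi>_def BP)
    ultimately show ?thesis by simp
  qed
  have "continuous_on D (\<lambda>x. \<psi>' (\<kappa> x))"
    by (rule continuous_on_compose2[OF \<psi>'(2) linear_continuous_on[OF \<kappa>bl]]) (use V0 in \<open>auto simp: D_def\<close>)
  then have cont\<Psi>': "continuous_on D \<Psi>'"
    unfolding \<Psi>'_def by (intro continuous_intros)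
  obtain x0 where x0: "x0 \<in> coord_space J" "\<Lambda> x0 = u0" using u0(2) \<Lambda>(2) by blast
  have \<kappa>eq: "\<kappa> x = \<Lambda> x" if "x \<in> coord_space J" for x using that by (simp add: \<kappa>_def coord_proj_eq_self)
  have "x0 \<in> D" using x0 V0 \<kappa>eq by (simp add: D_def)
  \<comment> \<open>Off \<open>J\<close> the derivative is the identity, so a kernel vector lies in
    \<open>coord_space J\<close>; its image in the tangent space then has zero
    \<open>J\<close>-coordinates and vanishes by the choice of \<open>J\<close>.\<close>
  have inj0: "inj (blinfun_apply (\<Psi>' x0))"
  proof (rule linear_injective_0[THEN iffD2, rule_format])
    show "linear (blinfun_apply (\<Psi>' x0))" by (rule bounded_linear.linear[OF blinfun.bounded_linear_right])
    fix v assume "blinfun_apply (\<Psi>' x0) v = 0"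
    then have e: "?P (\<psi>' u0 (\<kappa> v)) + (v - ?P v) = 0" using x0 \<kappa>eq by (simp add: \<Psi>'_apply)
    have "v $ i = 0" if "i \<notin> J" for i
      using arg_cong[OF e, of "\<lambda>w. w $ i"] that by (simp add: coord_proj_def)
    then have v: "v \<in> coord_space J" by (simp add: coord_space_def)
    then have "?P (\<psi>' u0 (\<Lambda> v)) = 0" using e \<kappa>eq by (simp add: coord_proj_eq_self)
    then have "\<psi>' u0 (\<Lambda> v) = 0" using J(2) \<Lambda>L[OF v] by blast
    then have "\<Lambda> v = 0" using \<psi>'(3)[OF u0(1)] lin\<psi> linear_0 by (metis injD)
    then show "v = 0" using \<Lambda>(1,3) v linear_0[OF \<Lambda>(1)] subspace_0[OF subspace_coord_space] by (metis inj_onD)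
  qed
  obtain g where g: "linear g" "g \<circ> blinfun_apply (\<Psi>' x0) = id"
    using linear_injective_left_inverse[OF bounded_linear.linear[OF blinfun.bounded_linear_right] inj0] by blast
  have "Blinfun g o\<^sub>L \<Psi>' x0 = id_blinfun"
    using g by (intro blinfun_eqI) (simp add: bounded_linear_Blinfun_apply linear_conv_bounded_linear o_def fun_eq_iff)
  from inverse_function_theorem[OF \<open>open D\<close> der\<Psi> cont\<Psi>' \<open>x0 \<in> D\<close> this]
  obtain U' O' \<Theta> \<Theta>' where U': "open U'" "U' \<subseteq> D" "x0 \<in> U'" and O': "open O'" "\<Psi> x0 \<in> O'"
    and hom': "homeomorphism U' O' \<Psi> \<Theta>"
    and der\<Theta>: "\<And>y. y \<in> O' \<Longrightarrow> (\<Theta> has_derivative (\<Theta>' y)) (at y)"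
    and \<Theta>': "\<And>y. y \<in> O' \<Longrightarrow> \<Theta>' y = inv (blinfun_apply (\<Psi>' (\<Theta> y)))"
    and bij: "\<And>y. y \<in> O' \<Longrightarrow> bij (blinfun_apply (\<Psi>' (\<Theta> y)))"
    by blast
  have \<Theta>: "\<Theta> x \<in> D" "\<Psi> (\<Theta> x) = x" if "x \<in> O'" for x
    using hom' that U'(2) unfolding homeomorphism_def by auto
  \<comment> \<open>\<open>\<Psi>\<close> leaves the coordinates outside \<open>J\<close> unchanged,
    hence so does its inverse.\<close>
  have \<Theta>J: "\<Theta> x \<in> coord_space J" if x: "x \<in> coord_space J \<inter> O'" for x
  proof -
    have "\<Theta> x $ i = 0" if "i \<notin> J" for i
      using arg_cong[OF \<Theta>(2)[of x], of "\<lambda>w. w $ i"] that x by (simp add: \<Psi>_def coord_proj_def coord_space_def)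
    then show ?thesis by (simp add: coord_space_def)
  qed
  define G where "G x = \<psi> (\<Lambda> (\<Theta> x))" for x
  have \<Lambda>\<Theta>: "\<Lambda> (\<Theta> x) \<in> V0" "\<Lambda> (\<Theta> x) \<in> L" if x: "x \<in> coord_space J \<inter> O'" for x
    using \<Theta>(1)[of x] \<Theta>J[OF x] x \<Lambda>L by (auto simp: D_def \<kappa>eq)
  have contG: "continuous_on (coord_space J \<inter> O') (\<lambda>x. \<psi> (\<Lambda> (\<Theta> x)))"
  proof (rule continuous_on_compose2[OF hom(6)])
    have "continuous_on O' \<Theta>" using hom' by (simp add: homeomorphism_def)
    then show "continuous_on (coord_space J \<inter> O') (\<lambda>x. \<Lambda> (\<Theta> x))"
      using linear_continuous_on[of \<Lambda> UNIV] \<Lambda>(1)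
      by (intro continuous_on_compose2[of UNIV \<Lambda> _ \<Theta>]) (auto intro: continuous_on_subset simp: linear_conv_bounded_linear)
    show "(\<lambda>x. \<Lambda> (\<Theta> x)) ` (coord_space J \<inter> O') \<subseteq> V" using \<Lambda>\<Theta> V0 by blast
  qed
  show ?thesis
  proof (rule that[of J O' G])
    have "\<Psi> x0 \<in> coord_space J" using x0 coord_proj_in by (simp add: \<Psi>_def coord_proj_eq_self)
    then show "coord_space J \<inter> O' \<noteq> {}" using O' by blast
    fix x assume x: "x \<in> coord_space J \<inter> O'"
    have "G x \<in> Y" "G x \<in> W"
      using \<Lambda>\<Theta>[OF x] slice_chart_mem(2)[OF ch(1)] by (auto simp: G_def V0_def)
    moreover have "G x $ j = x $ j" if "j \<in> J" for j
      using arg_cong[OF \<Theta>(2)[of x], of "\<lambda>w. w $ j"] that x \<Theta>J[OF x]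
      by (simp add: \<Psi>_def coord_proj_def G_def \<kappa>eq)
    ultimately show "G x \<in> Y \<inter> W \<and> (\<forall>j\<in>J. G x $ j = x $ j)" by blast
  next
    fix a :: "real ^ 'n" and b :: real assume ab: "rational_vec a" "a \<noteq> 0" "b \<in> \<rat>"
    have "avoidable J O' {x \<in> coord_space J \<inter> O'. (\<lambda>u. a \<bullet> \<psi> u - b) ((\<lambda>x. \<Lambda> (\<Theta> x)) x) = 0}"
    proof (rule avoidable_level_set[where h = "\<lambda>u. a \<bullet> \<psi> u - b" and \<Theta> = "\<lambda>x. \<Lambda> (\<Theta> x)" and L = L, OF O'(1) _ _ V(2), where \<Theta>' = "\<lambda>x v. \<Lambda> (\<Theta>' x v)"])
      show "continuous_on (coord_space J \<inter> O') ((\<lambda>u. a \<bullet> \<psi> u - b) \<circ> (\<lambda>x. \<Lambda> (\<Theta> x)))"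
        unfolding o_def by (intro continuous_intros contG)
      fix x assume x: "x \<in> coord_space J \<inter> O'"
      show "\<Lambda> (\<Theta> x) \<in> L" using \<Lambda>\<Theta>[OF x] by blast
      show "((\<lambda>x. \<Lambda> (\<Theta> x)) has_derivative (\<lambda>v. \<Lambda> (\<Theta>' x v))) (at x)"
        by (rule bounded_linear.has_derivative[OF linear_conv_bounded_linear[THEN iffD1, OF \<Lambda>(1)] der\<Theta>])
           (rule IntD2[OF x])
      \<comment> \<open>The derivative of \<open>\<Psi>\<close> maps \<open>coord_space J\<close>
        into itself, so the image of \<open>z\<close> is a vector of the slice that the inverse
        derivative sends back to \<open>z\<close>.\<close>
      show "\<exists>v\<in>coord_space J. \<Lambda> (\<Theta>' x v) = w" if w: "w \<in> L" for w
      proof -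
        obtain z where z: "z \<in> coord_space J" "\<Lambda> z = w" using w \<Lambda>(2) by blast
        let ?v = "blinfun_apply (\<Psi>' (\<Theta> x)) z"
        have "?v \<in> coord_space J" using z coord_proj_in by (simp add: \<Psi>'_apply coord_proj_eq_self)
        moreover have "\<Theta>' x ?v = z" using \<Theta>'[of x] bij[of x] x by (simp add: inv_f_f bij_is_inj)
        ultimately show ?thesis using z by (intro bexI[of _ ?v]) auto
      qed
      have u: "\<Lambda> (\<Theta> x) \<in> V" "\<Lambda> (\<Theta> x) \<in> L" using \<Lambda>\<Theta>[OF x] V0 by auto
      obtain r c where ps: "power_series_at (\<lambda>u. a \<bullet> \<psi> u - b) (\<Lambda> (\<Theta> x)) r c"
        by (rule slice_chart_power_series[OF ch(1) u(1)])
      \<comment> \<open>If all parts vanished on \<open>L\<close>, an open piece of \<open>Y\<close>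
        would lie in the hyperplane, against \<open>nonflat\<close>.\<close>
      moreover have "\<exists>m. \<exists>w\<in>L. hpart c m w \<noteq> 0"
      proof (rule ccontr)
        assume "\<not> (\<exists>m. \<exists>w\<in>L. hpart c m w \<noteq> 0)"
        then have flat: "\<And>m w. w \<in> L \<Longrightarrow> hpart c m w = 0" by blast
        obtain W' where "open W'" "\<psi> (\<Lambda> (\<Theta> x)) \<in> W'" "\<And>y. y \<in> Y \<inter> W' \<Longrightarrow> a \<bullet> y = b"
          using slice_chart_flat[OF ch(1) u ps flat] by metis
        then show False using nonflat[OF ab, of "\<psi> (\<Lambda> (\<Theta> x))" W'] slice_chart_mem(2)[OF ch(1) u] by blast
      qed
      ultimately show "\<exists>r c. power_series_at (\<lambda>u. a \<bullet> \<psi> u - b) (\<Lambda> (\<Theta> x)) r c \<and> (\<exists>m. \<exists>w\<in>L. hpart c m w \<noteq> 0)"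
        by blast
    qed
    then show "avoidable J O' {x \<in> coord_space J \<inter> O'. a \<bullet> G x = b}" by (simp add: G_def)
  qed (use J O' in auto)
qed

section \<open>Density and uncountability\<close>

lemma countable_rational_vec: "countable {a :: real ^ 'n. rational_vec a}"
proof -
  have "{a :: real ^ 'n. rational_vec a} \<subseteq> vec_lambda ` (PiE UNIV (\<lambda>_. \<rat>))"
  proof
    fix a :: "real ^ 'n" assume "a \<in> {a. rational_vec a}"
    then show "a \<in> vec_lambda ` (PiE UNIV (\<lambda>_. \<rat>))"
      by (intro image_eqI[of _ _ "vec_nth a"]) (auto simp: rational_vec_def)
  qed
  moreover have "countable (PiE (UNIV :: 'n set) (\<lambda>_. \<rat> :: real set))"
    by (intro countable_PiE countable_rat) auto
  ultimately show ?thesis by (rule countable_subset[OF _ countable_image])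
qed

text \<open>A rational system satisfied by \<open>x\<close> can only use equations with
  \<open>a = 0\<close>, and such an equation, being true at \<open>x\<close>, reads
  \<open>0 = 0\<close>. Its solution set is then the whole space.\<close>

lemma totally_irrationalI:
  assumes "\<And>a b. rational_vec a \<Longrightarrow> a \<noteq> 0 \<Longrightarrow> b \<in> \<rat> \<Longrightarrow> a \<bullet> x \<noteq> b"
  shows "totally_irrational x"
  unfolding totally_irrational_def
proof (intro allI impI notI)
  fix A assume A: "rational_affine_subspace A \<and> A \<noteq> UNIV" and xA: "x \<in> A"
  then have "\<exists>E. (\<forall>(a, b)\<in>E. rational_vec a \<and> b \<in> \<rat>) \<and> A = {x. \<forall>(a, b)\<in>E. a \<bullet> x = b}"
    by (simp only: rational_affine_subspace_def)
  then obtain E where E: "\<forall>(a, b)\<in>E. rational_vec a \<and> b \<in> \<rat>" "A = {x. \<forall>(a, b)\<in>E. a \<bullet> x = b}"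
    by (elim exE conjE)
  have zero: "a = 0 \<and> b = 0" if ab: "(a, b) \<in> E" for a b
  proof -
    have "rational_vec a" "b \<in> \<rat>" "a \<bullet> x = b" using E ab xA by auto
    then show ?thesis using assms by (metis inner_zero_left)
  qed
  have "A = UNIV" unfolding E(2) using zero by (force dest: zero)
  then show False using A by blast
qed

theorem theorem1p10:
  fixes Y :: "(real ^ 'n) set" and f :: "real \<Rightarrow> real" and d g :: nat
  assumes "connected Y"
    and "analytic_submanifold d Y"
    and "d \<ge> 2"
    and "\<And>H. rational_affine_hyperplane H \<Longrightarrow> \<not> Y \<subseteq> H"
    and "\<And>t. t > 0 \<Longrightarrow> f t > 0"
    and "antimono_on {0<..} f"
    and "1 \<le> g" and "g \<le> d - 1"
  shows "Y \<subseteq> closure (Y \<inter> UA_star f g) \<and> uncountable (Y \<inter> UA_star f g)"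
proof -
  \<comment> \<open>An open piece of \<open>Y\<close> inside a rational hyperplane would, by
    connectedness, force all of \<open>Y\<close> into it.\<close>
  have nonflat: "\<exists>y'\<in>Y \<inter> W. a \<bullet> y' \<noteq> b"
    if "rational_vec a" "a \<noteq> 0" "b \<in> \<rat>" "y \<in> Y" "open W" "y \<in> W" for a b y W
  proof (rule ccontr)
    assume "\<not> ?thesis"
    then have "Y \<subseteq> {x. a \<bullet> x = b}"
      using connected_submanifold_hyperplane[OF assms(1,2) that(5,4,6), of a b] by auto
    moreover have "rational_affine_hyperplane {x. a \<bullet> x = b}"
      using that unfolding rational_affine_hyperplane_def by blast
    ultimately show False using assms(4) by blast
  qed
  \<comment> \<open>One local statement gives both claims: uncountability with
    \<open>W = UNIV\<close>, and density with arbitrary neighbourhoods, since an uncountable set is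
    nonempty.\<close>
  have unc: "uncountable (Y \<inter> W \<inter> UA_star f g)" if W: "open W" "y0 \<in> Y" "y0 \<in> W" for y0 W
  proof
    assume cnt: "countable (Y \<inter> W \<inter> UA_star f g)"
    obtain J O' G where J: "card J = d" and O': "open O'" "coord_space J \<inter> O' \<noteq> {}"
      and G: "\<And>x. x \<in> coord_space J \<inter> O' \<Longrightarrow> G x \<in> Y \<inter> W \<and> (\<forall>j\<in>J. G x $ j = x $ j)"
      and av: "\<And>a b. rational_vec a \<Longrightarrow> a \<noteq> 0 \<Longrightarrow> b \<in> \<rat> \<Longrightarrow> avoidable J O' {x \<in> coord_space J \<inter> O'. a \<bullet> G x = b}"
      by (rule coordinate_chart[OF assms(2) W(2,3,1) nonflat]) ((assumption | rule that)+)
    have "g < card J" using assms J by auto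
    then have "J \<noteq> {}" by auto
    let ?H = "{a. rational_vec a \<and> a \<noteq> 0} \<times> \<rat>"
    let ?C = "{x \<in> coord_space J \<inter> O'. G x \<in> UA_star f g}"
    \<comment> \<open>If only countably many good points existed near \<open>y0\<close>, their
      parameters could be avoided together with the rational hyperplanes, and the construction would
      yield a good point not among them.\<close>
    define \<Z> where "\<Z> = (\<lambda>(a, b). {x \<in> coord_space J \<inter> O'. a \<bullet> G x = b}) ` ?H \<union> (\<lambda>c. {c}) ` ?C"
    have "inj_on G ?C"
    proof (rule inj_onI)
      fix x x' assume x: "x \<in> ?C" "x' \<in> ?C" "G x = G x'"
      have "x $ j = x' $ j" for j
        using x G[of x] G[of x'] by (cases "j \<in> J") (auto simp: coord_space_def)
      then show "x = x'" by (simp add: vec_eq_iff)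
    qed
    moreover have "countable (G ` ?C)" using G by (intro countable_subset[OF _ cnt]) blast
    ultimately have "countable ?C" by (rule countable_image_inj_on[rotated])
    moreover have "countable ?H"
      by (intro countable_SIGMA countable_rat countable_subset[OF _ countable_rational_vec]) auto
    ultimately have "countable \<Z>" unfolding \<Z>_def by (intro countable_Un countable_image)
    moreover have "avoidable J O' Z" if "Z \<in> \<Z>" for Z
      using that av avoidable_singleton[OF \<open>J \<noteq> {}\<close>] by (auto simp: \<Z>_def)
    ultimately obtain y where y: "y \<in> coord_space J \<inter> O'" "y \<notin> \<Union>\<Z>"
      and ev: "\<forall>\<^sub>F t in at_top. \<exists>q p. inj_on q {1..g} \<and> independent (q ` {1..g}) \<and>
        (\<forall>i\<in>{1..g}. integer_vec (q i) \<and> q i \<in> coord_space J \<and> infnorm (q i) \<le> t \<and> \<bar>q i \<bullet> y - of_int (p i)\<bar> \<le> f t)"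
      by (rule exists_uniformly_approximable_avoiding[where f = f, OF O' \<open>g < card J\<close> _ _ assms(5,6)])
    \<comment> \<open>Only coordinates shared by \<open>G y\<close> and \<open>y\<close> contribute,
      so the approximations found for \<open>y\<close> are approximations for
      \<open>G y\<close>.\<close>
    have "q \<bullet> G y = q \<bullet> y" if "q \<in> coord_space J" for q
      unfolding inner_vec_def using that G[OF y(1)] by (intro sum.cong) (auto simp: coord_space_def)
    then have "G y \<in> UA f g"
      unfolding UA_def mem_Collect_eq by (intro eventually_mono[OF ev]) (metis (no_types, lifting))
    moreover have "totally_irrational (G y)"
      using y by (intro totally_irrationalI) (auto simp: \<Z>_def)
    ultimately have "y \<in> ?C" using y by (simp add: UA_star_def)
    then show False using y by (auto simp: \<Z>_def)
  qed
  \<comment> \<open>The empty set would lie in every rational hyperplane, and one with an axis as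
    normal exists.\<close>
  have "Y \<noteq> {}"
  proof
    assume "Y = {}"
    moreover have "rational_affine_hyperplane {x :: real ^ 'n. axis undefined 1 \<bullet> x = 0}"
      unfolding rational_affine_hyperplane_def
      by (intro exI[of _ "axis undefined 1"] exI[of _ 0]) (auto simp: rational_vec_axis axis_eq_0_iff)
    ultimately show False using assms(4) by blast
  qed
  then have "uncountable (Y \<inter> UA_star f g)" using unc[of UNIV] by auto
  moreover have "y \<in> closure (Y \<inter> UA_star f g)" if y: "y \<in> Y" for y
    unfolding closure_iff_nhds_not_empty
  proof (intro allI impI)
    fix A B assume "B \<subseteq> A" "y \<in> B" "open B"
    then have "Y \<inter> B \<inter> UA_star f g \<noteq> {}" using unc[of B y] y by (metis countable_empty)
    then show "Y \<inter> UA_star f g \<inter> A \<noteq> {}" using \<open>B \<subseteq> A\<close> by blast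
  qed
  ultimately show ?thesis by blast
qed

end
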